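(* Let $\mu\ge0$ and let $W_\mu(x)=(1-\|x\|^2)^{\mu-1/2}$ on the unit ball $\mathbb{B}^d$. Let $f\in W_2^1(\mathbb{B}^d,W_\mu)$ satisfy $\int_{\mathbb{B}^d}f(x)W_\mu(x)\,dx=0$ and $\|f\|_{L^2(\mathbb{B}^d,W_\mu)}=1$. Then $$\min_{e\in\mathbb{S}^{d-1}}\ b_\mu\int_{\mathbb{B}^d}(1-\langle x,e\rangle)|f(x)|^2W_\mu(x)\,dx\ \cdot\ |||\nabla f|||^2\ \ge\ C_\mu,$$ where $$|||\nabla f|||^2:=\|\nabla f\|_{L^2(\mathbb{B}^d,W_{\mu+1})}^2+\|\nabla_Df\|_{L^2(\mathbb{B}^d,W_\mu)}^2$$ and, with $\lambda_\mu:=\mu+\frac{d-1}{2}$, $$C_\mu=2\lambda_\mu\left(1-\frac{\sqrt{2\lambda_\mu}}{\sqrt{(\lambda_\mu+\frac12)^2+2\lambda_\mu}}\right).$$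
   Context: Functions are real-valued. $\mathbb{S}^{d-1}$ is the unit sphere of $\mathbb{R}^d$. For each $\mu\ge0$, $b_\mu=\left(\int_{\mathbb{B}^d}W_\mu(x)\,dx\right)^{-1}$ and $\|f\|_{L^2(\mathbb{B}^d,W_\mu)}=\left(b_\mu\int_{\mathbb{B}^d}|f(x)|^2W_\mu(x)\,dx\right)^{1/2}$; for vector-valued functions $|\cdot|$ is the Euclidean norm. $W_2^1(\mathbb{B}^d,W_\mu)$ is the subspace of $L^2(\mathbb{B}^d,W_\mu)$ of functions all of whose first order (weak) derivatives are in $L^2(\mathbb{B}^d,W_\mu)$. $\nabla=(\partial_1,\dots,\partial_d)$, $D_{i,j}=x_i\partial_j-x_j\partial_i$, and $|\nabla_Df(x)|^2:=\sum_{1\le i<j\le d}|D_{i,j}f(x)|^2$. *)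

theory Defs
  imports "HOL-Analysis.Analysis"
begin

(* The ball is taken open. The sphere is a null set, so no integral below depends on this, and
   the base of the power is positive throughout, which powr requires for nonpositive exponents. *)

definition W :: "real \<Rightarrow> real^'n \<Rightarrow> real" where
  "W \<mu> x = (1 - (norm x)\<^sup>2) powr (\<mu> - 1/2)"

definition b :: "'n::finite itself \<Rightarrow> real \<Rightarrow> real" where
  "b TYPE('n) \<mu> = inverse (LINT x:ball (0 :: real^'n) 1|lebesgue. W \<mu> x)"

definition L2 :: "real \<Rightarrow> (real^'n \<Rightarrow> real) set" where
  "L2 \<mu> = {f. f \<in> borel_measurable (lebesgue_on (ball 0 1)) \<and>
              set_integrable lebesgue (ball 0 1) (\<lambda>x. \<bar>f x\<bar>\<^sup>2 * W \<mu> x)}"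

definition L2_norm :: "real \<Rightarrow> (real^'n \<Rightarrow> 'b::real_normed_vector) \<Rightarrow> real" where
  "L2_norm \<mu> f = sqrt (b TYPE('n) \<mu> * (LINT x:ball 0 1|lebesgue. (norm (f x))\<^sup>2 * W \<mu> x))"

definition classical_partial :: "'n::finite \<Rightarrow> (real^'n \<Rightarrow> real) \<Rightarrow> real^'n \<Rightarrow> real" where
  "classical_partial i \<phi> x = frechet_derivative \<phi> (at x) (axis i 1)"

primrec iterated_partial :: "'n::finite list \<Rightarrow> (real^'n \<Rightarrow> real) \<Rightarrow> real^'n \<Rightarrow> real" where
  "iterated_partial [] \<phi> = \<phi>"
| "iterated_partial (i # is) \<phi> = classical_partial i (iterated_partial is \<phi>)"

(* All iterated partials are differentiable, hence continuous: this is the class C^infinity. *)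
definition smooth :: "(real^'n \<Rightarrow> real) \<Rightarrow> bool" where
  "smooth \<phi> \<longleftrightarrow> (\<forall>is x. iterated_partial is \<phi> differentiable (at x))"

definition test_function :: "(real^'n) set \<Rightarrow> (real^'n \<Rightarrow> real) \<Rightarrow> bool" where
  "test_function U \<phi> \<longleftrightarrow>
     smooth \<phi> \<and> compact (closure {x. \<phi> x \<noteq> 0}) \<and> closure {x. \<phi> x \<noteq> 0} \<subseteq> U"

definition locally_integrable :: "(real^'n) set \<Rightarrow> (real^'n \<Rightarrow> real) \<Rightarrow> bool" where
  "locally_integrable U f \<longleftrightarrow> (\<forall>K. compact K \<and> K \<subseteq> U \<longrightarrow> set_integrable lebesgue K f)"

definition has_weak_partial :: "'n::finite \<Rightarrow> (real^'n \<Rightarrow> real) \<Rightarrow> (real^'n \<Rightarrow> real) \<Rightarrow> bool" where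
  "has_weak_partial i f g \<longleftrightarrow>
     locally_integrable (ball 0 1) f \<and> locally_integrable (ball 0 1) g \<and>
     (\<forall>\<phi>. test_function (ball 0 1) \<phi> \<longrightarrow>
        (LINT x:ball 0 1|lebesgue. f x * classical_partial i \<phi> x) =
        - (LINT x:ball 0 1|lebesgue. g x * \<phi> x))"

(* Weak derivatives are unique up to null sets; a representative is chosen, and only integrals
   and measurability conditions insensitive to that choice are ever applied to it. *)
definition weak_partial :: "'n::finite \<Rightarrow> (real^'n \<Rightarrow> real) \<Rightarrow> real^'n \<Rightarrow> real" where
  "weak_partial i f = (SOME g. has_weak_partial i f g)"

definition W21 :: "real \<Rightarrow> (real^'n \<Rightarrow> real) set" where
  "W21 \<mu> = {f \<in> L2 \<mu>. \<forall>i. (\<exists>g. has_weak_partial i f g) \<and> weak_partial i f \<in> L2 \<mu>}"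

definition grad :: "(real^'n \<Rightarrow> real) \<Rightarrow> real^'n \<Rightarrow> real^'n" where
  "grad f x = (\<chi> i. weak_partial i f x)"

definition D :: "'n::finite \<Rightarrow> 'n \<Rightarrow> (real^'n \<Rightarrow> real) \<Rightarrow> real^'n \<Rightarrow> real" where
  "D i j f x = x $ i * weak_partial j f x - x $ j * weak_partial i f x"

(* The linear order on the index type plays the role of the order on {1..d}; every d >= 1 is
   the cardinality of a linearly ordered finite type. *)
definition abs_grad_D :: "(real^('n::{finite,linorder}) \<Rightarrow> real) \<Rightarrow> real^('n::{finite,linorder}) \<Rightarrow> real" where
  "abs_grad_D f x = sqrt (\<Sum>(i, j)\<in>{(i, j). i < j}. \<bar>D i j f x\<bar>\<^sup>2)"

definition energy :: "real \<Rightarrow> (real^('n::{finite,linorder}) \<Rightarrow> real) \<Rightarrow> real" where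
  "energy \<mu> f = (L2_norm (\<mu> + 1) (grad f))\<^sup>2 + (L2_norm \<mu> (abs_grad_D f))\<^sup>2"

definition deviation :: "real \<Rightarrow> (real^'n \<Rightarrow> real) \<Rightarrow> real^'n \<Rightarrow> real" where
  "deviation \<mu> f e =
     b TYPE('n) \<mu> * (LINT x:ball 0 1|lebesgue. (1 - x \<bullet> e) * \<bar>f x\<bar>\<^sup>2 * W \<mu> x)"

definition lam :: "nat \<Rightarrow> real \<Rightarrow> real" where
  "lam d \<mu> = \<mu> + (real d - 1) / 2"

definition C :: "nat \<Rightarrow> real \<Rightarrow> real" where
  "C d \<mu> = 2 * lam d \<mu> *
     (1 - sqrt (2 * lam d \<mu>) / sqrt ((lam d \<mu> + 1/2)\<^sup>2 + 2 * lam d \<mu>))"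

end

(* The energy is the Dirichlet form of the operator L whose eigenfunctions are the orthogonal
   polynomials of the weight W_mu, the eigenvalue in degree n being -n(n + 2 lambda). Integration by
   parts against a polynomial q gives form(f, q) = - <f, L q>, so the projections p_n of f onto
   polynomials of degree less than n satisfy form(p_n, p_n) <= form(f, f) and every inequality needs
   a proof for polynomials only. Two are used, with t = <x, e>: the spectral gap form(p, p) >=
   (2 lambda + 1) <p, p> for p of mean zero, and
   ((lambda + 1/2) <t p, p>)^2 <= <(1 - t^2) p, p> form(p, p), which comes from L t = -(2 lambda + 1) t
   and the Cauchy-Schwarz inequality. If the first moment of f^2 is small the first inequality gives
   the bound, otherwise the second one does. *)

theory Submission
  imports Defs
begin

text \<open>The obstacle is the boundary. Weak derivatives are tested only against functions
  supported inside the ball, and for mu < 1/2 the weight is unbounded at the sphere, so a polynomial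
  times a power of 1 - |x|^2 has to be cut off, and the derivative of the cutoff must disappear in
  the limit. The family \<open>cutoff\<close> is closed under differentiation up to a shift of
  exponents, and its error terms are dominated by the weight itself. Polynomials are shown to be
  dense only in the weighted L2 space; no approximation of f in the Sobolev norm is made. The
  energies of the projections are merely bounded by that of f, and the limit is taken in integrals
  of w times a square with bounded w. The two terms of the energy carry different normalizations, b
  at mu + 1 and b at mu, whereas the Dirichlet form carries b at mu throughout. The energy is
  therefore compared with the form by an inequality. Let kappa = (lambda + 1/2)^2. The threshold for
  the first moment is the s with kappa s^2 = 2 lambda (1 - s^2): at m = s and E = 2 lambda the
  uncertainty inequality is an equality, and C is (1 - s) 2 lambda.\<close>

abbreviation pd :: "'n::finite \<Rightarrow> (real^'n \<Rightarrow> real) \<Rightarrow> real^'n \<Rightarrow> real" where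
  "pd \<equiv> classical_partial"

section \<open>Polynomials and the differential operator of the weight\<close>

lemma pd_eqI: "(f has_derivative f') (at x) \<Longrightarrow> pd i f x = f' (axis i 1)"
  unfolding classical_partial_def using frechet_derivative_at by metis

lemma pd_const [simp]: "pd i (\<lambda>x. c) = (\<lambda>x. 0)"
  by (rule ext, rule pd_eqI[THEN trans]) (auto intro!: derivative_eq_intros)

lemma pd_add:
  assumes "p differentiable (at x)" "q differentiable (at x)"
  shows "pd i (\<lambda>x. p x + q x) x = pd i p x + pd i q x"
proof -
  note d = assms[THEN frechet_derivative_works[THEN iffD1]]
  show ?thesis
    by (subst pd_eqI[OF has_derivative_add[OF d]]) (simp add: classical_partial_def)
qed

lemma pd_mult:
  assumes "p differentiable (at x)" "q differentiable (at x)"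
  shows "pd i (\<lambda>x. p x * q x) x = pd i p x * q x + p x * pd i q x"
proof -
  note d = assms[THEN frechet_derivative_works[THEN iffD1]]
  show ?thesis
    by (subst pd_eqI[OF has_derivative_mult[OF d]]) (simp add: classical_partial_def)
qed

lemma pd_coord [simp]: "pd i (\<lambda>x::real^'n. x $ k) = (\<lambda>x. if i = k then 1 else 0)"
proof
  fix x :: "real^'n"
  show "pd i (\<lambda>x. x $ k) x = (if i = k then 1 else 0)"
    by (subst pd_eqI[OF bounded_linear_imp_has_derivative[OF bounded_linear_vec_nth]])
      (auto simp: axis_def)
qed

lemma coord_differentiable [simp]: "(\<lambda>x::real^'n. x $ k) differentiable (at x)"
  by (rule bounded_linear_imp_differentiable[OF bounded_linear_vec_nth])

text \<open>Combinations grow by one generator at a time, so a fact about the whole span follows by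
  induction from the generators.\<close>

inductive_set lspan :: "('a \<Rightarrow> real) set \<Rightarrow> ('a \<Rightarrow> real) set" for S where
  zero: "(\<lambda>x. 0) \<in> lspan S"
| step: "p \<in> lspan S \<Longrightarrow> s \<in> S \<Longrightarrow> (\<lambda>x. p x + c * s x) \<in> lspan S"

lemma lspan_base: "s \<in> S \<Longrightarrow> s \<in> lspan S"
  using lspan.step[OF lspan.zero, of s S 1] by simp

lemma lspan_add:
  assumes "p \<in> lspan S" "q \<in> lspan S"
  shows "(\<lambda>x. p x + q x) \<in> lspan S"
  using assms(2)
proof induction
  case (step q s c)
  then show ?case using lspan.step[OF step.IH step.hyps(2), of c] by (simp add: add.assoc)
qed (use assms(1) in simp)

lemma lspan_scale: "p \<in> lspan S \<Longrightarrow> (\<lambda>x. c * p x) \<in> lspan S"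
proof (induction rule: lspan.induct)
  case (step p s a)
  then show ?case using lspan.step[OF step.IH step.hyps(2), of "c * a"]
    by (simp add: distrib_left mult.assoc)
qed (simp add: lspan.zero)

lemma lspan_diff: "p \<in> lspan S \<Longrightarrow> q \<in> lspan S \<Longrightarrow> (\<lambda>x. p x - q x) \<in> lspan S"
  using lspan_add[OF _ lspan_scale[of q S "-1"], of p] by simp

lemma lspan_sum:
  "finite I \<Longrightarrow> (\<And>i. i \<in> I \<Longrightarrow> p i \<in> lspan S) \<Longrightarrow> (\<lambda>x. \<Sum>i\<in>I. p i x) \<in> lspan S"
  by (induction rule: finite_induct) (auto intro: lspan.zero lspan_add)

text \<open>Linearity of \<open>T\<close> is demanded only on the span, because \<open>pd\<close>,
  \<open>euler\<close> and \<open>ball_op\<close> are linear on differentiable functions and not on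
  all functions.\<close>

lemma lspan_image:
  assumes "p \<in> lspan S" "T (\<lambda>x. 0) = (\<lambda>x. 0)" "\<And>s. s \<in> S \<Longrightarrow> T s \<in> lspan S'"
    and "\<And>p s c. p \<in> lspan S \<Longrightarrow> s \<in> S \<Longrightarrow> T (\<lambda>x. p x + c * s x) = (\<lambda>x. T p x + c * T s x)"
  shows "T p \<in> lspan S'"
  using assms(1)
proof induction
  case zero
  then show ?case by (simp add: assms(2) lspan.zero)
next
  case (step p s c)
  then show ?case by (simp add: assms(3,4) lspan_add lspan_scale)
qed

lemma lspan_mono: "p \<in> lspan S \<Longrightarrow> S \<subseteq> S' \<Longrightarrow> p \<in> lspan S'"
  by (induction rule: lspan.induct) (auto intro: lspan.intros)

text \<open>Monomials of degree strictly less than \<open>n\<close>.\<close>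

primrec monoms :: "nat \<Rightarrow> (real^'n \<Rightarrow> real) set" where
  "monoms 0 = {}"
| "monoms (Suc n) = insert (\<lambda>x. 1) (\<Union>i. (\<lambda>m x. x $ i * m x) ` monoms n)"

abbreviation Pol :: "nat \<Rightarrow> (real^'n \<Rightarrow> real) set" where
  "Pol n \<equiv> lspan (monoms n)"

lemma finite_monoms: "finite (monoms n :: (real^'n \<Rightarrow> real) set)"
  by (induction n) auto

lemma monoms_Suc_cases:
  assumes "m \<in> monoms (Suc n)"
  obtains "m = (\<lambda>x. 1)" | k m' where "m = (\<lambda>x. x $ k * m' x)" "m' \<in> monoms n"
  using assms by auto

lemma monoms_subset_Suc: "monoms n \<subseteq> monoms (Suc n)"
proof (induction n)
  case (Suc n)
  show ?case unfolding monoms.simps(2)[of "Suc n"] monoms.simps(2)[of n]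
    using Suc by (intro insert_mono UN_mono image_mono) auto
qed simp

declare monoms.simps(2) [simp del]

lemma monoms_mono: "n \<le> k \<Longrightarrow> monoms n \<subseteq> monoms k"
  using lift_Suc_mono_le[of monoms, OF monoms_subset_Suc] by blast

lemma Pol_mono: "p \<in> Pol n \<Longrightarrow> n \<le> k \<Longrightarrow> p \<in> Pol k"
  using lspan_mono monoms_mono by blast

lemma Pol_Suc: "p \<in> Pol n \<Longrightarrow> p \<in> Pol (Suc n)"
  using Pol_mono[of p n "Suc n"] by simp

lemma Pol_const: "(\<lambda>x. c) \<in> Pol (Suc n)"
  using lspan_scale[OF lspan_base[of "\<lambda>x. 1" "monoms (Suc n)"], of c] by (simp add: monoms.simps)

lemma Pol_coord_mult: "p \<in> Pol n \<Longrightarrow> (\<lambda>x. x $ i * p x) \<in> Pol (Suc n)"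
  by (erule lspan_image[where T = "\<lambda>p x. x $ i * p x"]) (auto intro: lspan_base simp: algebra_simps monoms.simps)

lemma Pol_coord: "(\<lambda>x. x $ i) \<in> Pol (Suc (Suc n))"
  using Pol_coord_mult[OF Pol_const[of 1 n], of i] by simp

text \<open>The bounds are strict, so the degree is in fact at most n + k - 2; the coarser index
  avoids truncated subtraction, and callers use only that some index exists.\<close>

lemma Pol_mult:
  assumes p: "p \<in> Pol n" and q: "q \<in> Pol k"
  shows "(\<lambda>x. p x * q x) \<in> Pol (n + k)"
proof -
  have "m \<in> monoms n \<Longrightarrow> (\<lambda>x. m x * q x) \<in> Pol (n + k)" for m
  proof (induction n arbitrary: m)
    case (Suc n)
    from Suc.prems show ?case
    proof (cases rule: monoms_Suc_cases)
      case 1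
      then show ?thesis using Pol_mono[OF q] by simp
    next
      case (2 i m')
      then show ?thesis using Pol_coord_mult[OF Suc.IH[of m'], of i] by (simp add: mult.assoc)
    qed
  qed simp
  with p show ?thesis
    by (rule_tac lspan_image[where T = "\<lambda>p x. p x * q x"]) (auto simp: algebra_simps)
qed

lemma monoms_differentiable: "m \<in> monoms n \<Longrightarrow> m differentiable (at x)"
proof (induction n arbitrary: m)
  case (Suc n)
  from Suc.prems show ?case
    by (cases rule: monoms_Suc_cases) (auto simp: Suc.IH)
qed simp

lemma Pol_differentiable: "p \<in> Pol n \<Longrightarrow> p differentiable (at x)"
  by (induction rule: lspan.induct) (auto simp: monoms_differentiable)

lemma Pol_continuous: "p \<in> Pol n \<Longrightarrow> continuous_on S p"
  by (meson Pol_differentiable continuous_at_imp_continuous_on differentiable_imp_continuous_within)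

lemma pd_coord_mult:
  "p differentiable (at x) \<Longrightarrow>
    pd i (\<lambda>x. x $ k * p x) x = (if i = k then p x else 0) + x $ k * pd i p x"
  by (simp add: pd_mult)

lemma pd_lin:
  assumes "p differentiable (at x)" "q differentiable (at x)"
  shows "pd i (\<lambda>x. p x + c * q x) x = pd i p x + c * pd i q x"
  using assms by (simp add: pd_add pd_mult differentiable_mult)

lemma monoms_pd: "m \<in> monoms (Suc n) \<Longrightarrow> pd i m \<in> Pol n"
proof (induction n arbitrary: m)
  case 0
  then show ?case by (auto simp: monoms.simps intro: lspan.zero)
next
  case (Suc n)
  from Suc.prems show ?case
  proof (cases rule: monoms_Suc_cases)
    case 1
    then show ?thesis by (simp add: lspan.zero)
  next
    case (2 k m')
    have "pd i m = (\<lambda>x. (if i = k then m' x else 0) + x $ k * pd i m' x)"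
      using 2 by (auto simp: pd_coord_mult monoms_differentiable)
    moreover have "(\<lambda>x. if i = k then m' x else 0) \<in> Pol (Suc n)"
      using lspan_base[OF 2(2)] by (cases "i = k") (auto intro: lspan.zero)
    ultimately show ?thesis
      using lspan_add Pol_coord_mult[OF Suc.IH[OF 2(2)], of k] by simp
  qed
qed

lemma Pol_pd_Suc: "p \<in> Pol (Suc n) \<Longrightarrow> pd i p \<in> Pol n"
  by (erule lspan_image[where T = "pd i"])
    (auto intro: monoms_pd Pol_differentiable monoms_differentiable pd_lin)

lemma Pol_pd: "p \<in> Pol n \<Longrightarrow> pd i p \<in> Pol n"
  by (rule Pol_pd_Suc[OF Pol_Suc])

section \<open>The Euler operator, the ball operator and their action on leading terms\<close>

definition euler :: "(real^'n \<Rightarrow> real) \<Rightarrow> real^'n \<Rightarrow> real" where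
  "euler p x = (\<Sum>i\<in>UNIV. x $ i * pd i p x)"

lemma euler_lin:
  assumes "p differentiable (at x)" "q differentiable (at x)"
  shows "euler (\<lambda>x. p x + c * q x) x = euler p x + c * euler q x"
  using assms by (simp add: euler_def pd_lin algebra_simps sum.distrib sum_distrib_left)

lemma euler_coord_mult:
  assumes "p differentiable (at x)"
  shows "euler (\<lambda>x. x $ k * p x) x = x $ k * p x + x $ k * euler p x"
  unfolding euler_def pd_coord_mult[OF assms]
  by (simp add: distrib_left mult.left_commute sum.distrib sum_distrib_left if_distrib[of "(*) _"] cong: if_cong)

text \<open>Euler's identity for homogeneous functions: a monomial of degree exactly n leaves
  remainder 0, and one of smaller degree lies in \<open>Pol n\<close> anyway. The induction on
  coordinate factors treats both at once.\<close>

lemma monoms_euler: "m \<in> monoms (Suc n) \<Longrightarrow> (\<lambda>x. euler m x - n * m x) \<in> Pol n"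
proof (induction n arbitrary: m)
  case 0
  then show ?case by (auto simp: monoms.simps euler_def intro: lspan.zero)
next
  case (Suc n)
  from Suc.prems show ?case
  proof (cases rule: monoms_Suc_cases)
    case 1
    then show ?thesis using Pol_const[of "- (1 + real n)"] by (simp add: euler_def)
  next
    case (2 k m')
    have "(\<lambda>x. euler m x - Suc n * m x) = (\<lambda>x. x $ k * (euler m' x - n * m' x))"
      unfolding 2(1) euler_coord_mult[OF monoms_differentiable[OF 2(2)]]
      by (rule ext) (simp add: algebra_simps)
    then show ?thesis
      using Pol_coord_mult[OF Suc.IH[OF 2(2)], of k] by simp
  qed
qed

text \<open>The angular part of the operator, the sum over \<open>i < j\<close> of \<open>D_ij^2\<close>, is expanded, so that no
  order on the index type is needed.\<close>

definition ball_op :: "real \<Rightarrow> (real^'n \<Rightarrow> real) \<Rightarrow> real^'n \<Rightarrow> real" where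
  "ball_op \<mu> p x = (\<Sum>i\<in>UNIV. pd i (pd i p) x)
     - (\<Sum>i\<in>UNIV. \<Sum>j\<in>UNIV. x $ i * x $ j * pd j (pd i p) x)
     - (2 * \<mu> + real CARD('n)) * euler p x"

lemma pd_pd_lin:
  assumes "p \<in> Pol n" "q \<in> Pol n"
  shows "pd j (pd i (\<lambda>x. p x + c * q x)) x = pd j (pd i p) x + c * pd j (pd i q) x"
proof -
  have "pd i (\<lambda>x. p x + c * q x) = (\<lambda>x. pd i p x + c * pd i q x)"
    using assms by (auto intro: pd_lin Pol_differentiable)
  then show ?thesis
    by (simp only: pd_lin[OF Pol_differentiable[OF Pol_pd[OF assms(1)]] Pol_differentiable[OF Pol_pd[OF assms(2)]]])
qed

lemma pd_pd_coord_mult: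
  assumes "p \<in> Pol n"
  shows "pd j (pd i (\<lambda>x. x $ k * p x)) x =
    (if i = k then pd j p x else 0) + (if j = k then pd i p x else 0) + x $ k * pd j (pd i p) x"
proof -
  have d: "p differentiable (at y)" "(\<lambda>x. x $ k * pd i p x) differentiable (at y)"
    "pd i p differentiable (at y)" for y
    using Pol_differentiable[OF assms] Pol_differentiable[OF Pol_coord_mult[OF Pol_pd[OF assms]]]
      Pol_differentiable[OF Pol_pd[OF assms]] by blast+
  \<comment> \<open>The Kronecker delta is written as a scalar coefficient, so that
    \<open>pd_lin\<close> differentiates the whole sum once more.\<close>
  have "pd i (\<lambda>x. x $ k * p x) = (\<lambda>x. x $ k * pd i p x + (if i = k then 1 else 0) * p x)"
    by (rule ext) (simp add: pd_coord_mult[OF d(1)])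
  then show ?thesis
    by (simp add: pd_lin[OF d(2,1)] pd_coord_mult[OF d(3)])
qed

lemma ball_op_lin:
  assumes "p \<in> Pol n" "q \<in> Pol n"
  shows "ball_op \<mu> (\<lambda>x. p x + c * q x) x = ball_op \<mu> p x + c * ball_op \<mu> q x"
  unfolding ball_op_def pd_pd_lin[OF assms] euler_lin[OF assms[THEN Pol_differentiable]]
  by (simp add: algebra_simps sum.distrib sum_distrib_left)

text \<open>The commutator of the operator with multiplication by x_k: the Laplacian contributes 2
  d_k, the second-order radial part 2 x_k times the Euler operator, and the Euler operator
  x_k.\<close>

lemma ball_op_coord_mult:
  assumes "p \<in> Pol n"
  shows "ball_op \<mu> (\<lambda>x. x $ k * p x) (x::real^'n) =
    x $ k * ball_op \<mu> p x + 2 * pd k p x - (2 * \<mu> + real CARD('n)) * (x $ k * p x) - 2 * x $ k * euler p x"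
proof -
  have "(\<Sum>i\<in>UNIV. \<Sum>j\<in>UNIV. x $ i * x $ j * pd j (pd i (\<lambda>x. x $ k * p x)) x)
    = (\<Sum>i\<in>UNIV. \<Sum>j\<in>UNIV. if i = k then x $ i * x $ j * pd j p x else 0)
    + (\<Sum>i\<in>UNIV. \<Sum>j\<in>UNIV. if j = k then x $ i * x $ j * pd i p x else 0)
    + x $ k * (\<Sum>i\<in>UNIV. \<Sum>j\<in>UNIV. x $ i * x $ j * pd j (pd i p) x)"
  proof -
    have "x $ i * x $ j * pd j (pd i (\<lambda>x. x $ k * p x)) x =
      (if i = k then x $ i * x $ j * pd j p x else 0) + (if j = k then x $ i * x $ j * pd i p x else 0)
      + x $ k * (x $ i * x $ j * pd j (pd i p) x)" for i j
      unfolding pd_pd_coord_mult[OF assms] by (simp add: distrib_left)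
    then show ?thesis
      by (simp only: sum.distrib sum_distrib_left)
  qed
  also have "(\<Sum>i\<in>UNIV. \<Sum>j\<in>UNIV. if i = k then x $ i * x $ j * pd j p x else 0) = x $ k * euler p x"
    by (subst sum.swap) (simp add: euler_def sum_distrib_left mult.assoc)
  also have "(\<Sum>i\<in>UNIV. \<Sum>j\<in>UNIV. if j = k then x $ i * x $ j * pd i p x else 0) = x $ k * euler p x"
    by (simp add: euler_def sum_distrib_left algebra_simps)
  finally have 1: "(\<Sum>i\<in>UNIV. \<Sum>j\<in>UNIV. x $ i * x $ j * pd j (pd i (\<lambda>x. x $ k * p x)) x)
    = 2 * x $ k * euler p x + x $ k * (\<Sum>i\<in>UNIV. \<Sum>j\<in>UNIV. x $ i * x $ j * pd j (pd i p) x)"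
    by simp
  have 2: "(\<Sum>i\<in>UNIV. pd i (pd i (\<lambda>x. x $ k * p x)) x) = 2 * pd k p x + x $ k * (\<Sum>i\<in>UNIV. pd i (pd i p) x)"
    by (simp add: pd_pd_coord_mult[OF assms] sum.distrib flip: sum_distrib_left)
  show ?thesis
    unfolding ball_op_def 1 2 euler_coord_mult[OF Pol_differentiable[OF assms]]
    by (simp add: algebra_simps)
qed

lemma ball_op_const: "ball_op \<mu> (\<lambda>x. c) = (\<lambda>x. 0)"
  by (auto simp: ball_op_def euler_def)

text \<open>The eigenvalue accumulates one coordinate factor at a time. By the commutator formula
  and \<open>monoms_euler\<close>, passing from n to n + 1 adds 2n + 2 mu + d = 2n + 1 + 2 lambda,
  which is (n + 1)(n + 1 + 2 lambda) - n(n + 2 lambda). Everything else has lower degree.\<close>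

lemma monoms_ball_op:
  assumes "m \<in> (monoms (Suc n) :: (real^'n \<Rightarrow> real) set)"
  shows "(\<lambda>x. ball_op \<mu> m x + real n * (real n + 2 * lam CARD('n) \<mu>) * m x) \<in> Pol n"
  using assms
proof (induction n arbitrary: m)
  case 0
  then show ?case by (auto simp: monoms.simps ball_op_const intro: lspan.zero)
next
  case (Suc n)
  let ?l = "2 * lam CARD('n) \<mu>"
  from Suc.prems show ?case
  proof (cases rule: monoms_Suc_cases)
    case 1
    then show ?thesis using Pol_const[of "(1 + real n) * (1 + real n + ?l)"] by (simp add: ball_op_const)
  next
    case (2 k m')
    note P = lspan_base[OF 2(2)]
    have "(\<lambda>x. ball_op \<mu> m x + Suc n * (Suc n + ?l) * m x) =
      (\<lambda>x. x $ k * (ball_op \<mu> m' x + n * (n + ?l) * m' x) + 2 * pd k m' x + (-2) * (x $ k * (euler m' x - n * m' x)))"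
      unfolding 2(1) ball_op_coord_mult[OF P] by (rule ext) (simp add: lam_def field_simps)
    also have "\<dots> \<in> Pol (Suc n)"
      by (intro lspan_add lspan_scale Pol_coord_mult[OF Suc.IH[OF 2(2)]] Pol_coord_mult[OF monoms_euler[OF 2(2)]]
          Pol_Suc[OF Pol_pd_Suc[OF P]])
    finally show ?thesis .
  qed
qed

lemma Pol_ball_op_Suc:
  assumes "p \<in> (Pol (Suc n) :: (real^'n \<Rightarrow> real) set)"
  shows "(\<lambda>x. ball_op \<mu> p x + real n * (real n + 2 * lam CARD('n) \<mu>) * p x) \<in> Pol n"
  using assms
  apply (rule lspan_image[where T = "\<lambda>p x. ball_op \<mu> p x + real n * (real n + 2 * lam CARD('n) \<mu>) * p x"])
  subgoal by (simp add: ball_op_const)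
  subgoal by (rule monoms_ball_op)
  subgoal for p s c using ball_op_lin[of p "Suc n" s] lspan_base[of s "monoms (Suc n)"] by (simp add: algebra_simps del: monoms.simps)
  done

lemma Pol_ball_op: 
  assumes "p \<in> Pol n"
  shows "ball_op \<mu> p \<in> Pol n"
proof -
  have "(\<lambda>x. (ball_op \<mu> p x + real n * (real n + 2 * lam CARD('a) \<mu>) * p x) - real n * (real n + 2 * lam CARD('a) \<mu>) * p x) \<in> Pol n"
    using Pol_ball_op_Suc[OF Pol_Suc[OF assms]] by (rule lspan_diff) (rule lspan_scale[OF assms])
  then show ?thesis by simp
qed

text \<open>Carries the approximants given by the Stone-Weierstrass theorem into the graded spaces
  \<open>Pol n\<close>.\<close>

lemma real_polynomial_function_Pol:
  assumes "real_polynomial_function p"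
  shows "\<exists>n. p \<in> Pol n"
  using assms
proof induction
  case (linear f)
  have "f = (\<lambda>x. \<Sum>i\<in>UNIV. f (axis i 1) * x $ i)"
  proof
    fix x
    have "f x = f (\<Sum>i\<in>UNIV. x $ i *\<^sub>R axis i 1)"
      using basis_expansion[of x] by (simp add: scalar_mult_eq_scaleR)
    then show "f x = (\<Sum>i\<in>UNIV. f (axis i 1) * x $ i)"
      using linear by (simp add: linear_sum bounded_linear.linear linear_cmul mult.commute)
  qed
  moreover have "(\<lambda>x. \<Sum>i\<in>UNIV. f (axis i 1) * x $ i) \<in> Pol (Suc (Suc 0))"
    by (intro lspan_sum lspan_scale Pol_coord) auto
  ultimately show ?case by metis
next
  case (const c)
  then show ?case using Pol_const by blast
next
  case (add p q)
  then obtain n k where "p \<in> Pol n" "q \<in> Pol k" by blast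
  then have "(\<lambda>x. p x + q x) \<in> Pol (n + k)"
    by (intro lspan_add) (auto elim!: Pol_mono)
  then show ?case by blast
next
  case (mult p q)
  then show ?case using Pol_mult by blast
qed

section \<open>Test functions\<close>

text \<open>The parameter \<open>d\<close> occurs both as the distance to the boundary and in the exponent; this
  scaling makes \<open>cutoff_le\<close> and \<open>cutoff_le'\<close> uniform in \<open>d\<close>.\<close>

definition cutoff :: "real \<Rightarrow> real \<Rightarrow> real \<Rightarrow> real" where
  "cutoff d a t = (if t < 1 - d then (1 - d - t) powr a * exp (- d / (1 - d - t)) else 0)"

text \<open>For u < 1 and k >= -a the power is at most a constant times (d/u)^k, and exp (d/u)
  outgrows every power of d/u.\<close>

lemma powr_exp_inverse_tendsto_0:
  assumes "d > 0"
  shows "((\<lambda>u::real. u powr a * exp (- d / u)) \<longlongrightarrow> 0) (at_right 0)"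
proof -
  obtain k :: nat where k: "- a \<le> real k"
    using real_arch_simple by blast
  have "filterlim (\<lambda>u. d * inverse u) at_top (at_right 0)"
    by (rule filterlim_tendsto_pos_mult_at_top[OF tendsto_const assms filterlim_inverse_at_top_right])
  from filterlim_compose[OF tendsto_power_div_exp_0[of k] this]
  have lim: "((\<lambda>u. inverse (d ^ k) * ((d * inverse u) ^ k / exp (d * inverse u))) \<longlongrightarrow> 0) (at_right 0)"
    by (rule tendsto_mult_right_zero)
  have "eventually (\<lambda>u::real. 0 < u \<and> u < 1) (at_right 0)"
    using eventually_at_right_real[of 0 "1::real"] by simp
  then have "eventually (\<lambda>u. norm (u powr a * exp (- d / u)) \<le> inverse (d ^ k) * ((d * inverse u) ^ k / exp (d * inverse u))) (at_right 0)"
  proof eventually_elim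
    case (elim u)
    then have "u powr a \<le> u powr (- real k)"
      using k by (intro powr_mono') auto
    also have "\<dots> = inverse (d ^ k) * (d * inverse u) ^ k"
      using elim assms by (simp add: powr_minus powr_realpow power_mult_distrib power_inverse)
    finally have "u powr a * exp (- d / u) \<le> inverse (d ^ k) * (d * inverse u) ^ k * exp (- d / u)"
      by (intro mult_right_mono) auto
    then show ?case
      using elim by (simp add: exp_minus field_simps)
  qed
  from Lim_null_comparison[OF this lim] show ?thesis .
qed

text \<open>Differentiating the power lowers the exponent by 1, and differentiating exp (- d/u)
  brings out d/u^2, so derivatives stay in the family for every real a. At t = 1 - d the exponential
  flatness gives derivative 0.\<close>

lemma cutoff_has_derivative:
  assumes d: "d > 0"
  shows "(cutoff d a has_real_derivative - (a * cutoff d (a - 1) t + d * cutoff d (a - 2) t)) (at t)"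
proof -
  consider "t < 1 - d" | "t > 1 - d" | "t = 1 - d" by linarith
  then show ?thesis
  proof cases
    case 1
    have "((\<lambda>t. (1 - d - t) powr a * exp (- d / (1 - d - t))) has_real_derivative
        - (a * cutoff d (a - 1) t + d * cutoff d (a - 2) t)) (at t)"
      using 1 
      apply (auto intro!: derivative_eq_intros simp: cutoff_def)
      apply (simp add: powr_diff powr_numeral power2_eq_square field_simps)
      done
    then show ?thesis
      by (rule DERIV_cong_ev[OF refl _ refl, THEN iffD1, rotated])
        (use 1 in \<open>auto simp: cutoff_def eventually_nhds intro!: exI[of _ "{..<1 - d}"]\<close>)
  next
    case 2
    have "((\<lambda>t. 0) has_real_derivative - (a * cutoff d (a - 1) t + d * cutoff d (a - 2) t)) (at t)"
      using 2 by (simp add: cutoff_def)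
    then show ?thesis
      by (rule DERIV_cong_ev[OF refl _ refl, THEN iffD1, rotated])
        (use 2 in \<open>auto simp: cutoff_def eventually_nhds intro!: exI[of _ "{1 - d<..}"]\<close>)
  next
    case 3
    have "((\<lambda>h. cutoff d a (t + h) / h) \<longlongrightarrow> 0) (at_right 0)"
      by (rule tendsto_eventually, rule eventually_mono[OF eventually_at_right_less]) (simp add: 3 cutoff_def)
    moreover have "((\<lambda>h. cutoff d a (t + h) / h) \<longlongrightarrow> 0) (at_left 0)"
    proof -
      \<comment> \<open>After the reflection of h the left difference quotient at the junction is
        minus a cutoff expression with exponent a - 1, which still tends to 0.\<close>
      have lim: "((\<lambda>h. - (h powr (a - 1) * exp (- d / h))) \<longlongrightarrow> - 0) (at_right 0)"
        by (intro tendsto_minus powr_exp_inverse_tendsto_0 d)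
      have ev: "eventually (\<lambda>h. - (h powr (a - 1) * exp (- d / h)) = cutoff d a (t + - h) / - h) (at_right 0)"
        using eventually_at_right_less[of "0::real"]
        by eventually_elim (simp add: 3 cutoff_def powr_diff)
      have "((\<lambda>h. cutoff d a (t + - h) / - h) \<longlongrightarrow> 0) (at_right 0)"
        using Lim_transform_eventually[OF lim ev] by (simp only: minus_zero)
      then show ?thesis
        by (subst filterlim_at_left_to_right) simp
    qed
    ultimately have "((\<lambda>h. cutoff d a (t + h) / h) \<longlongrightarrow> 0) (at 0)"
      by (rule filterlim_split_at[rotated])
    then show ?thesis
      by (simp add: DERIV_def 3 cutoff_def)
  qed
qed

lemma cutoff_nonneg: "cutoff d a t \<ge> 0"
  by (simp add: cutoff_def)

text \<open>Put u = 1 - d - t. For negative a the power of u alone exceeds that of u + d = 1 - t,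
  and the exponential compensates: (1 + d/u)^(-a) <= 1 + d/u <= exp (d/u), because -a <= 1.\<close>

lemma cutoff_le:
  assumes "d > 0" "a \<ge> - 1/2" "t < 1"
  shows "cutoff d a t \<le> (1 - t) powr a"
proof (cases "t < 1 - d")
  case True
  define u where "u = 1 - d - t"
  have u: "u > 0" "1 - t = u + d" using True by (auto simp: u_def)
  have "u powr a * exp (- d / u) \<le> (u + d) powr a"
  proof (cases "a \<ge> 0")
    case a: True
    have "u powr a * exp (- d / u) \<le> u powr a * 1"
      using u assms by (intro mult_left_mono) auto
    also have "\<dots> \<le> (u + d) powr a"
      using u assms a by (auto intro!: powr_mono2)
    finally show ?thesis .
  next
    case False
    have "((u + d) / u) powr (- a) \<le> ((u + d) / u) powr 1"
      using u assms False by (intro powr_mono) auto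
    also have "\<dots> = 1 + d / u"
      using u assms by (simp add: field_simps)
    also have "\<dots> \<le> exp (d / u)"
      by (rule exp_ge_add_one_self)
    finally have "((u + d) / u) powr (- a) * exp (- d / u) \<le> exp (d / u) * exp (- d / u)"
      by (rule mult_right_mono) simp
    also have "\<dots> = 1"
      by (simp flip: exp_add)
    finally have "(u + d) powr a * (((u + d) / u) powr (- a) * exp (- d / u)) \<le> (u + d) powr a * 1"
      by (rule mult_left_mono) simp
    moreover have "u powr a * exp (- d / u) = (u + d) powr a * (((u + d) / u) powr (- a) * exp (- d / u))"
      using u assms by (simp add: powr_divide powr_minus)
    ultimately show ?thesis by (simp only: mult_1_right)
  qed
  moreover have "cutoff d a t = u powr a * exp (- d / u)"
    using True by (simp add: cutoff_def u_def)
  ultimately show ?thesis by (simp only: u(2))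
qed (use assms in \<open>simp add: cutoff_def\<close>)

text \<open>With u = 1 - d - t and y = d/u the left side is (u + d)^a times y (1 + y)^(-a) exp (-
  y), and the last product is at most 2 because y (1 + y) <= 2 (1 + y + y^2/2) <= 2 exp y.\<close>

lemma cutoff_le':
  assumes "d > 0" "a \<ge> - 1/2" "t < 1"
  shows "d * cutoff d (a - 1) t \<le> 2 * (1 - t) powr a"
proof (cases "t < 1 - d")
  case True
  define u where "u = 1 - d - t"
  define y where "y = d / u"
  have u: "u > 0" "1 - t = u + d" "y > 0" using True assms by (auto simp: u_def y_def)
  have ud: "u + d = u * (1 + y)" using u by (simp add: y_def field_simps)
  have y: "y * ((1 + y) powr (-a) * exp (- y)) \<le> 2"
  proof -
    have "(1 + y) powr (-a) \<le> (1 + y) powr 1"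
      using u assms by (intro powr_mono) auto
    then have "(1 + y) powr (-a) * exp (- y) \<le> (1 + y) * exp (- y)"
      using u by (intro mult_right_mono) auto
    then have "y * ((1 + y) powr (-a) * exp (- y)) \<le> y * ((1 + y) * exp (- y))"
      using u by (intro mult_left_mono) auto
    also have "\<dots> \<le> 2 * exp y * exp (- y)"
    proof -
      have "y * (1 + y) \<le> 2 * (1 + y + y\<^sup>2 / 2)"
        using u by (simp add: power2_eq_square algebra_simps)
      also have "\<dots> \<le> 2 * exp y"
        using exp_lower_Taylor_quadratic[of y] u by simp
      finally show ?thesis
        unfolding mult.assoc[symmetric] by (rule mult_right_mono) simp
    qed
    also have "\<dots> = 2"
      by (simp add: mult.assoc flip: exp_add)
    finally show ?thesis .
  qed
  have "d * (u powr (a - 1) * exp (- d / u)) = (u + d) powr a * (y * ((1 + y) powr (-a) * exp (- y)))"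
  proof -
    have "d = u * y" "u powr (a - 1) = u powr a / u" "d / u = y"
      using u by (auto simp: y_def powr_diff)
    then show ?thesis
      unfolding ud using u by (simp add: powr_mult powr_minus)
  qed
  also have "\<dots> \<le> (u + d) powr a * 2"
    by (intro mult_left_mono y) auto
  finally have "d * (u powr (a - 1) * exp (- d / u)) \<le> 2 * (u + d) powr a"
    by (simp only: mult.commute)
  moreover have "cutoff d (a - 1) t = u powr (a - 1) * exp (- d / u)"
    using True by (simp add: cutoff_def u_def)
  ultimately show ?thesis by (simp only: u(2))
qed (use assms in \<open>simp add: cutoff_def\<close>)

lemma cutoff_tendsto:
  assumes "t < 1"
  shows "((\<lambda>d. cutoff d a t) \<longlongrightarrow> (1 - t) powr a) (at_right 0)"
proof -
  have "eventually (\<lambda>d. d < 1 - t) (at_right 0)"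
    using assms by (intro eventually_at_right_real[THEN eventually_mono]) auto
  then have "eventually (\<lambda>d. (1 - d - t) powr a * exp (- d / (1 - d - t)) = cutoff d a t) (at_right 0)"
    by eventually_elim (auto simp: cutoff_def)
  moreover have "((\<lambda>d. (1 - d - t) powr a * exp (- d / (1 - d - t))) \<longlongrightarrow> (1 - 0 - t) powr a * exp (- 0 / (1 - 0 - t))) (at_right 0)"
    using assms by (intro tendsto_intros) auto
  ultimately show ?thesis by (simp add: tendsto_cong)
qed

section \<open>Polynomials times a cutoff power of 1 - |x|^2\<close>

definition bump :: "real \<Rightarrow> real \<Rightarrow> (real^'n \<Rightarrow> real) \<Rightarrow> real^'n \<Rightarrow> real" where
  "bump d a p x = p x * cutoff d a ((norm x)\<^sup>2)"

lemma cutoff_norm_has_derivative: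
  assumes "d > 0"
  shows "((\<lambda>x::real^'n. cutoff d a ((norm x)\<^sup>2)) has_derivative
    (\<lambda>h. - (a * cutoff d (a - 1) ((norm x)\<^sup>2) + d * cutoff d (a - 2) ((norm x)\<^sup>2)) * (2 * (x \<bullet> h)))) (at x)"
proof -
  have "((\<lambda>x. (norm x)\<^sup>2) has_derivative (\<lambda>h. 2 * (x \<bullet> h))) (at x)"
    unfolding power2_norm_eq_inner by (auto intro!: derivative_eq_intros simp: inner_commute)
  from has_derivative_compose[OF this cutoff_has_derivative[OF assms, THEN has_field_derivative_imp_has_derivative]]
  show ?thesis by simp
qed

lemma bump_differentiable:
  "d > 0 \<Longrightarrow> p \<in> Pol n \<Longrightarrow> bump d a p differentiable (at x)"
  unfolding bump_def
  by (intro differentiable_mult) (auto simp: Pol_differentiable intro: differentiableI[OF cutoff_norm_has_derivative])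

lemma pd_bump:
  assumes "d > 0" "p \<in> Pol n"
  shows "pd i (bump d a p) x = bump d a (pd i p) x
    - 2 * a * bump d (a - 1) (\<lambda>x. x $ i * p x) x - 2 * d * bump d (a - 2) (\<lambda>x. x $ i * p x) x"
proof -
  have "pd i (\<lambda>x. p x * cutoff d a ((norm x)\<^sup>2)) x = pd i p x * cutoff d a ((norm x)\<^sup>2)
      + p x * pd i (\<lambda>x. cutoff d a ((norm x)\<^sup>2)) x"
    using assms by (intro pd_mult) (auto simp: Pol_differentiable intro: differentiableI[OF cutoff_norm_has_derivative])
  then show ?thesis
    unfolding bump_def pd_eqI[OF cutoff_norm_has_derivative[OF assms(1)]]
    by (simp add: inner_axis algebra_simps)
qed

text \<open>By \<open>pd_bump\<close> a partial derivative of one bump is a combination of bumps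
  with exponents a, a - 1 and a - 2. Closing under combinations yields a class of differentiable
  functions stable under every \<open>pd i\<close>, which is what \<open>smooth\<close> asks
  for.\<close>

inductive_set bumps :: "real \<Rightarrow> (real^'n \<Rightarrow> real) set" for d where
  bump: "p \<in> Pol n \<Longrightarrow> bump d a p \<in> bumps d"
| lin: "f \<in> bumps d \<Longrightarrow> g \<in> bumps d \<Longrightarrow> (\<lambda>x. f x + c * g x) \<in> bumps d"

lemma bumps_differentiable: "f \<in> bumps d \<Longrightarrow> d > 0 \<Longrightarrow> f differentiable (at x)"
  by (induction rule: bumps.induct) (auto simp: bump_differentiable)

lemma bumps_pd: "f \<in> bumps d \<Longrightarrow> d > 0 \<Longrightarrow> pd i f \<in> bumps d"
proof (induction rule: bumps.induct)
  case (bump p n a)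
  have "pd i (bump d a p) = (\<lambda>x. (bump d a (pd i p) x
    + (- 2 * a) * bump d (a - 1) (\<lambda>x. x $ i * p x) x) + (- 2 * d) * bump d (a - 2) (\<lambda>x. x $ i * p x) x)"
    using bump by (auto simp: pd_bump)
  also have "\<dots> \<in> bumps d"
    by (intro bumps.lin) (auto intro!: bumps.bump Pol_pd bump Pol_coord_mult)
  finally show ?case .
next
  case (lin f g c)
  have "pd i (\<lambda>x. f x + c * g x) = (\<lambda>x. pd i f x + c * pd i g x)"
    using lin by (intro ext pd_lin) (auto simp: bumps_differentiable)
  then show ?case using lin by (auto intro: bumps.lin)
qed

lemma bumps_smooth:
  assumes "f \<in> bumps d" "d > 0"
  shows "smooth f"
proof -
  have "iterated_partial is f \<in> bumps d" for "is"
    by (induction "is") (auto intro: assms bumps_pd)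
  then show ?thesis
    unfolding smooth_def using bumps_differentiable assms(2) by blast
qed

lemma bump_test_function:
  fixes p :: "real^'n \<Rightarrow> real"
  assumes "0 < d" "d < 1" "p \<in> Pol n"
  shows "test_function (ball 0 1) (bump d a p)"
proof -
  have "{x. bump d a p x \<noteq> 0} \<subseteq> cball 0 (sqrt (1 - d))"
  proof
    fix x assume "x \<in> {x. bump d a p x \<noteq> 0}"
    then have "(norm x)\<^sup>2 \<le> 1 - d"
      by (simp add: bump_def cutoff_def split: if_splits)
    then show "x \<in> cball 0 (sqrt (1 - d))"
      using real_le_rsqrt[of "norm x" "1 - d"] by simp
  qed
  then have sub: "closure {x. bump d a p x \<noteq> 0} \<subseteq> cball 0 (sqrt (1 - d))"
    by (intro closure_minimal) auto
  moreover have "compact (closure {x. bump d a p x \<noteq> 0})"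
    using bounded_subset[OF bounded_cball sub] by (simp add: compact_eq_bounded_closed)
  moreover have "cball (0::real^'n) (sqrt (1 - d)) \<subseteq> ball 0 1"
    using assms by (simp add: cball_subset_ball_iff)
  ultimately show ?thesis
    unfolding test_function_def using bumps_smooth[OF bumps.bump[OF assms(3)] assms(1)] sub
    by (meson order_trans)
qed

section \<open>Square-integrable functions\<close>

definition square_integrable :: "'a measure \<Rightarrow> ('a \<Rightarrow> real) \<Rightarrow> bool" where
  "square_integrable M f \<longleftrightarrow> f \<in> borel_measurable M \<and> integrable M (\<lambda>x. (f x)\<^sup>2)"

lemma square_integrable_measurable: "square_integrable M f \<Longrightarrow> f \<in> borel_measurable M"
  by (simp add: square_integrable_def)

lemma square_integrable_mult:
  assumes "square_integrable M f" "square_integrable M g"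
  shows "integrable M (\<lambda>x. f x * g x)"
proof (rule Bochner_Integration.integrable_bound)
  show "integrable M (\<lambda>x. (f x)\<^sup>2 + (g x)\<^sup>2)"
    using assms by (simp add: square_integrable_def)
  show "AE x in M. norm (f x * g x) \<le> norm ((f x)\<^sup>2 + (g x)\<^sup>2)"
  proof (rule AE_I2)
    fix x
    have "2 * (\<bar>f x\<bar> * \<bar>g x\<bar>) \<le> \<bar>f x\<bar>\<^sup>2 + \<bar>g x\<bar>\<^sup>2"
      using sum_squares_bound[of "\<bar>f x\<bar>" "\<bar>g x\<bar>"] by (simp add: mult.assoc)
    moreover have "\<bar>f x\<bar> * \<bar>g x\<bar> \<ge> 0" by simp
    ultimately have "\<bar>f x\<bar> * \<bar>g x\<bar> \<le> (f x)\<^sup>2 + (g x)\<^sup>2" unfolding power2_abs by linarith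
    then show "norm (f x * g x) \<le> norm ((f x)\<^sup>2 + (g x)\<^sup>2)"
      by (simp add: abs_mult)
  qed
qed (use assms in \<open>auto simp: square_integrable_def\<close>)

lemma square_integrable_scale: "square_integrable M f \<Longrightarrow> square_integrable M (\<lambda>x. c * f x)"
  by (auto simp: square_integrable_def power_mult_distrib)

lemma square_integrable_add:
  assumes "square_integrable M f" "square_integrable M g"
  shows "square_integrable M (\<lambda>x. f x + g x)"
  using assms square_integrable_mult[OF assms]
  by (auto simp: square_integrable_def power2_sum mult.assoc)

lemma square_integrable_diff:
  assumes "square_integrable M f" "square_integrable M g"
  shows "square_integrable M (\<lambda>x. f x - g x)"
  using square_integrable_add[OF assms(1) square_integrable_scale[OF assms(2), of "-1"]] by simp

lemma square_integrable_sum: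
  "finite I \<Longrightarrow> (\<And>i. i \<in> I \<Longrightarrow> square_integrable M (f i)) \<Longrightarrow> square_integrable M (\<lambda>x. \<Sum>i\<in>I. f i x)"
proof (induction rule: finite_induct)
  case empty
  then show ?case by (simp add: square_integrable_def)
qed (simp add: square_integrable_add)

lemma square_integrable_bounded_mult:
  assumes "square_integrable M f" "h \<in> borel_measurable M" "\<And>x. x \<in> space M \<Longrightarrow> \<bar>h x\<bar> \<le> B"
  shows "square_integrable M (\<lambda>x. h x * f x)"
proof -
  have "integrable M (\<lambda>x. (h x * f x)\<^sup>2)"
  proof (rule Bochner_Integration.integrable_bound)
    show "integrable M (\<lambda>x. B\<^sup>2 * (f x)\<^sup>2)" using assms(1) by (simp add: square_integrable_def)
    show "AE x in M. norm ((h x * f x)\<^sup>2) \<le> norm (B\<^sup>2 * (f x)\<^sup>2)"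
    proof (rule AE_I2)
      fix x assume "x \<in> space M"
      then have "\<bar>h x\<bar>\<^sup>2 \<le> B\<^sup>2" using assms(3) by (intro power_mono) auto
      then show "norm ((h x * f x)\<^sup>2) \<le> norm (B\<^sup>2 * (f x)\<^sup>2)"
        by (simp add: power_mult_distrib mult_right_mono)
    qed
  qed (use assms in \<open>auto simp: square_integrable_def\<close>)
  then show ?thesis using assms by (auto simp: square_integrable_def)
qed

text \<open>The source of both Cauchy-Schwarz inequalities below, for integrals and for the
  Dirichlet form. The sign of p is not assumed, so it is derived here from nonnegativity for large
  c.\<close>

lemma quadratic_discriminant:
  fixes p q r :: real
  assumes "\<And>c. p * c\<^sup>2 + 2 * q * c + r \<ge> 0"
  shows "q\<^sup>2 \<le> p * r"
proof (cases "p = 0")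
  case True
  have "q = 0"
  proof (rule ccontr)
    assume "q \<noteq> 0"
    \<comment> \<open>With p = 0 the expression is affine in c and equals -1 at this point.\<close>
    then show False using assms[of "- (r + 1) / (2 * q)"] True by simp
  qed
  then show ?thesis by (simp add: True)
next
  case False
  have "p \<ge> 0"
  proof (rule ccontr)
    assume p: "\<not> p \<ge> 0"
    \<comment> \<open>Chosen so that c >= 1 and p c + 2 q <= - |r| - 1, which makes the quadratic
      negative.\<close>
    define c where "c = (2 * \<bar>q\<bar> + \<bar>r\<bar> + 1) / (- p) + 1"
    have c: "c \<ge> 1" "p * c = - (2 * \<bar>q\<bar> + \<bar>r\<bar> + 1) + p"
      using p by (auto simp: c_def field_simps divide_nonneg_neg divide_nonpos_neg intro: divide_nonneg_neg)
    have "p * c\<^sup>2 + 2 * q * c + r = (p * c + 2 * q) * c + r"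
      by (simp add: power2_eq_square algebra_simps)
    also have "\<dots> \<le> (- \<bar>r\<bar> - 1) * c + r"
      using c p by (intro add_right_mono mult_right_mono) auto
    also have "\<dots> \<le> (- \<bar>r\<bar> - 1) * 1 + r"
      using c by (intro add_right_mono mult_left_mono_neg) auto
    also have "\<dots> < 0" by simp
    finally show False using assms[of c] by simp
  qed
  have "p * (- q / p)\<^sup>2 + 2 * q * (- q / p) + r = r - q\<^sup>2 / p"
    using False by (simp add: power2_eq_square field_simps)
  then have "q\<^sup>2 / p \<le> r" using assms[of "- q / p"] by simp
  then show ?thesis using False \<open>p \<ge> 0\<close> by (simp add: divide_le_eq mult.commute)
qed

lemma integral_Cauchy_Schwarz:
  assumes "square_integrable M f" "square_integrable M g"
  shows "(\<integral>x. f x * g x \<partial>M)\<^sup>2 \<le> (\<integral>x. (f x)\<^sup>2 \<partial>M) * (\<integral>x. (g x)\<^sup>2 \<partial>M)"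
proof (rule quadratic_discriminant)
  fix c :: real
  note [simp] = square_integrable_mult[OF assms]
  have [simp]: "integrable M (\<lambda>x. (f x)\<^sup>2)" "integrable M (\<lambda>x. (g x)\<^sup>2)"
    using assms by (auto simp: square_integrable_def)
  have "0 \<le> (\<integral>x. (c * f x + g x)\<^sup>2 \<partial>M)" by simp
  also have "\<dots> = (\<integral>x. c\<^sup>2 * (f x)\<^sup>2 + 2 * c * (f x * g x) + (g x)\<^sup>2 \<partial>M)"
    by (intro Bochner_Integration.integral_cong) (auto simp: power2_eq_square algebra_simps)
  also have "\<dots> = (\<integral>x. (f x)\<^sup>2 \<partial>M) * c\<^sup>2 + 2 * (\<integral>x. f x * g x \<partial>M) * c + (\<integral>x. (g x)\<^sup>2 \<partial>M)"
    by (simp add: mult.commute)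
  finally show "0 \<le> (\<integral>x. (f x)\<^sup>2 \<partial>M) * c\<^sup>2 + 2 * (\<integral>x. f x * g x \<partial>M) * c + (\<integral>x. (g x)\<^sup>2 \<partial>M)" .
qed

section \<open>Integrals of partial derivatives of compactly supported functions\<close>

lemma partial_has_derivative_along_axis:
  assumes "\<psi> differentiable (at (x + t *\<^sub>R axis i 1))"
  shows "((\<lambda>t. \<psi> (x + t *\<^sub>R axis i 1)) has_real_derivative pd i \<psi> (x + t *\<^sub>R axis i 1)) (at t)"
proof -
  let ?F = "frechet_derivative \<psi> (at (x + t *\<^sub>R axis i 1))"
  have F: "(\<psi> has_derivative ?F) (at (x + t *\<^sub>R axis i 1))"
    using assms frechet_derivative_works by blast
  have "((\<lambda>t. \<psi> (x + t *\<^sub>R axis i 1)) has_derivative (\<lambda>h. ?F (h *\<^sub>R axis i 1))) (at t)"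
  proof -
    have "((\<lambda>t. x + t *\<^sub>R axis i 1) has_derivative (\<lambda>h. h *\<^sub>R axis i 1)) (at t)"
      by (rule derivative_eq_intros refl | simp)+
    from has_derivative_compose[OF this, of \<psi> ?F] F show ?thesis by simp
  qed
  then show ?thesis
    unfolding has_field_derivative_def classical_partial_def
    by (simp add: linear_cmul[OF has_derivative_linear[OF F]] mult_commute_abs)
qed

lemma lborel_integral_translate:
  fixes f :: "'a::euclidean_space \<Rightarrow> real"
  assumes "f \<in> borel_measurable borel"
  shows "(\<integral>x. f (c + x) \<partial>lborel) = (\<integral>x. f x \<partial>lborel)"
proof -
  have "(\<integral>x. f x \<partial>lborel) = (\<integral>x. f x \<partial>distr lborel borel ((+) c))"
    by (simp add: lborel_distr_plus)
  also have "\<dots> = (\<integral>x. f (c + x) \<partial>lborel)"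
    using assms by (subst integral_distr) auto
  finally show ?thesis ..
qed

text \<open>Difference quotients along the axis have integral 0 by translation invariance, and they
  converge to the partial derivative. The mean value theorem supplies the bound for dominated
  convergence.\<close>

lemma integral_partial_eq_0:
  fixes \<psi> :: "real^'n \<Rightarrow> real"
  assumes diff: "\<And>x. \<psi> differentiable (at x)" and cont: "continuous_on UNIV (pd i \<psi>)"
    and supp: "\<And>x. x \<notin> cball 0 R \<Longrightarrow> \<psi> x = 0"
  shows "(\<integral>x. pd i \<psi> x \<partial>lborel) = 0"
proof -
  let ?e = "axis i 1 :: real^'n"
  define s where "s = (\<lambda>n x. (\<psi> (inverse (Suc n) *\<^sub>R ?e + x) - \<psi> x) * Suc n)"
  have contp: "continuous_on S \<psi>" for S
    by (meson diff continuous_at_imp_continuous_on differentiable_imp_continuous_within)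
  then have meas: "\<psi> \<in> borel_measurable borel"
    by (intro borel_measurable_continuous_onI)
  \<comment> \<open>Steps have length at most 1, so the quotient vanishes for |x| > R + 1, and the
    mean value point of any other x lies in the ball of radius R + 2.\<close>
  have "compact (pd i \<psi> ` cball 0 (R + 2))"
    by (intro compact_continuous_image continuous_on_subset[OF cont]) auto
  then obtain B where B: "\<And>x. x \<in> cball 0 (R + 2) \<Longrightarrow> \<bar>pd i \<psi> x\<bar> \<le> B"
    using compact_imp_bounded bounded_iff by (metis image_eqI real_norm_def)
  have bound: "norm (s n x) \<le> indicator (cball 0 (R + 1)) x * B" for n x
  proof (cases "x \<in> cball 0 (R + 1)")
    case False
    have "norm (inverse (Suc n) *\<^sub>R ?e) \<le> 1"
      by (simp add: inverse_le_1_iff)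
    moreover have "norm x \<le> norm (inverse (Suc n) *\<^sub>R ?e + x) + norm (inverse (Suc n) *\<^sub>R ?e)"
      using norm_triangle_ineq4[of "inverse (Suc n) *\<^sub>R ?e + x" "inverse (Suc n) *\<^sub>R ?e"] by simp
    ultimately have "inverse (Suc n) *\<^sub>R ?e + x \<notin> cball 0 R" "x \<notin> cball 0 R"
      using False unfolding mem_cball_0 by linarith+
    then have "\<psi> (inverse (Suc n) *\<^sub>R ?e + x) = 0" "\<psi> x = 0"
      using supp by blast+
    then show ?thesis using False by (simp add: s_def)
  next
    case True
    let ?h = "inverse (real (Suc n))"
    obtain z where z: "0 < z" "z < ?h"
      and eq: "\<psi> (x + ?h *\<^sub>R ?e) - \<psi> (x + 0 *\<^sub>R ?e) = (?h - 0) * pd i \<psi> (x + z *\<^sub>R ?e)"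
      using MVT2[of 0 ?h "\<lambda>t. \<psi> (x + t *\<^sub>R ?e)" "\<lambda>t. pd i \<psi> (x + t *\<^sub>R ?e)"]
        partial_has_derivative_along_axis[OF diff] by auto
    have "?h \<le> 1" by (simp add: inverse_le_1_iff)
    then have "norm (z *\<^sub>R ?e) \<le> 1" using z by simp
    then have "x + z *\<^sub>R ?e \<in> cball 0 (R + 2)"
      using True norm_triangle_ineq[of x "z *\<^sub>R ?e"] unfolding mem_cball_0 by linarith
    then have "\<bar>pd i \<psi> (x + z *\<^sub>R ?e)\<bar> \<le> B" by (rule B)
    moreover have "s n x = pd i \<psi> (x + z *\<^sub>R ?e)"
      using eq by (simp add: s_def add.commute)
    ultimately show ?thesis using True by simp
  qed
  have "(\<lambda>n. integral\<^sup>L lborel (s n)) \<longlonglongrightarrow> integral\<^sup>L lborel (pd i \<psi>)"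
  proof (rule integral_dominated_convergence)
    show "pd i \<psi> \<in> borel_measurable lborel"
      using borel_measurable_continuous_onI[OF cont] by simp
    show "s n \<in> borel_measurable lborel" for n
      unfolding s_def using meas by measurable
    show "integrable lborel (\<lambda>x. indicator (cball 0 (R + 1)) x * B)"
      by (intro integrable_mult_left integrable_real_indicator) (use emeasure_bounded_finite[OF bounded_cball] in \<open>auto simp: less_top\<close>)
    show "AE x in lborel. norm (s n x) \<le> indicator (cball 0 (R + 1)) x * B" for n
      using bound by simp
    show "AE x in lborel. (\<lambda>n. s n x) \<longlonglongrightarrow> pd i \<psi> x"
    proof (rule AE_I2)
      fix x
      have "((\<lambda>t. \<psi> (x + t *\<^sub>R ?e)) has_real_derivative pd i \<psi> x) (at 0)"
        using partial_has_derivative_along_axis[of \<psi> x 0 i] diff by simp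
      then have lim: "((\<lambda>h. (\<psi> (x + h *\<^sub>R ?e) - \<psi> x) / h) \<longlongrightarrow> pd i \<psi> x) (at 0)"
        by (simp add: DERIV_def)
      have "filterlim (\<lambda>n. inverse (real (Suc n))) (at 0) sequentially"
        unfolding filterlim_at using LIMSEQ_inverse_real_of_nat by simp
      from filterlim_compose[OF lim this]
      show "(\<lambda>n. s n x) \<longlonglongrightarrow> pd i \<psi> x"
        by (simp add: s_def add.commute divide_inverse)
    qed
  qed
  moreover have "integral\<^sup>L lborel (s n) = 0" for n
  proof -
    have int: "integrable lborel \<psi>"
    proof -
      have "integrable lborel (\<lambda>x. indicator (cball 0 R) x *\<^sub>R \<psi> x)"
        by (rule borel_integrable_compact) (auto intro: contp)
      moreover have "(\<lambda>x. indicator (cball 0 R) x *\<^sub>R \<psi> x) = \<psi>"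
      proof
        fix x show "indicator (cball 0 R) x *\<^sub>R \<psi> x = \<psi> x"
          using supp[of x] by (cases "x \<in> cball 0 R") auto
      qed
      ultimately show ?thesis by simp
    qed
    have "integrable lborel (\<lambda>x. \<psi> (inverse (Suc n) *\<^sub>R ?e + x))"
    proof -
      have "integrable (distr lborel borel ((+) (inverse (Suc n) *\<^sub>R ?e))) \<psi>"
        using int by (simp add: lborel_distr_plus)
      then show ?thesis
        using meas by (subst (asm) integrable_distr_eq) auto
    qed
    then show ?thesis
      unfolding s_def using int by (simp add: lborel_integral_translate[OF meas])
  qed
  ultimately show ?thesis
    by (simp add: LIMSEQ_const_iff)
qed

section \<open>The weighted ball and integration by parts\<close>

abbreviation lebesgue_ball :: "(real^'n) measure" where
  "lebesgue_ball \<equiv> lebesgue_on (ball 0 1)"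

lemma W_measurable: "W \<mu> \<in> borel_measurable borel"
  unfolding W_def by measurable

lemma measurable_lebesgue_onI: "f \<in> borel_measurable borel \<Longrightarrow> f \<in> borel_measurable (lebesgue_on S)"
  by (intro measurable_restrict_space1 measurable_completion) simp

text \<open>With the weight absorbed into the measure, weighted norms and orthogonality become
  statements about \<open>square_integrable\<close> functions on one measure.\<close>

definition ballM :: "real \<Rightarrow> (real^'n) measure" where
  "ballM \<mu> = density lebesgue_ball (\<lambda>x. ennreal (W \<mu> x))"

lemma W_nonneg: "W \<mu> x \<ge> 0"
  by (simp add: W_def)

lemma space_ballM [simp]: "space (ballM \<mu>) = ball 0 1"
  by (simp add: ballM_def space_restrict_space)

lemma measurable_ballM [simp]: "borel_measurable (ballM \<mu>) = borel_measurable lebesgue_ball"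
  by (simp add: ballM_def measurable_def)

lemma set_integral_lebesgue_on:
  fixes f :: "real^'n \<Rightarrow> real"
  shows "(LINT x:ball 0 1|lebesgue. f x) = integral\<^sup>L lebesgue_ball f"
  by (simp add: set_lebesgue_integral_def integral_restrict_space)

lemma set_integrable_lebesgue_on:
  fixes f :: "real^'n \<Rightarrow> real"
  shows "set_integrable lebesgue (ball 0 1) f \<longleftrightarrow> integrable lebesgue_ball f"
  by (simp add: set_integrable_def integrable_restrict_space)

lemma integral_ballM:
  assumes "f \<in> borel_measurable lebesgue_ball"
  shows "integral\<^sup>L (ballM \<mu>) f = integral\<^sup>L lebesgue_ball (\<lambda>x. f x * W \<mu> x)"
  unfolding ballM_def
  using assms by (subst integral_density) (auto simp: W_nonneg mult.commute intro: measurable_lebesgue_onI W_measurable)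

lemma integrable_ballM:
  assumes "f \<in> borel_measurable lebesgue_ball"
  shows "integrable (ballM \<mu>) f \<longleftrightarrow> integrable lebesgue_ball (\<lambda>x. f x * W \<mu> x)"
  unfolding ballM_def
  using assms by (subst integrable_density) (auto simp: W_nonneg mult.commute intro: measurable_lebesgue_onI W_measurable)

lemma continuous_measurable_ball:
  "continuous_on UNIV f \<Longrightarrow> f \<in> borel_measurable lebesgue_ball"
  by (intro measurable_lebesgue_onI borel_measurable_continuous_onI)

lemma Pol_measurable: "p \<in> Pol n \<Longrightarrow> p \<in> borel_measurable lebesgue_ball"
  by (intro continuous_measurable_ball Pol_continuous)

lemma Pol_bounded:
  assumes "p \<in> Pol n"
  obtains B where "\<And>x. x \<in> ball 0 1 \<Longrightarrow> \<bar>p x\<bar> \<le> B"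
proof -
  have "compact (p ` cball 0 1)"
    by (intro compact_continuous_image Pol_continuous[OF assms]) auto
  then obtain B where "\<And>x. x \<in> cball 0 1 \<Longrightarrow> \<bar>p x\<bar> \<le> B"
    using compact_imp_bounded bounded_iff by (metis image_eqI real_norm_def)
  then show ?thesis using that by (meson ball_subset_cball subsetD)
qed

lemma locally_integrable_mult_continuous:
  fixes f :: "real^'n \<Rightarrow> real"
  assumes f: "locally_integrable U f" and K: "compact K" "K \<subseteq> U" and U: "U \<in> sets lebesgue"
    and cont: "continuous_on UNIV \<phi>" and supp: "\<And>x. x \<notin> K \<Longrightarrow> \<phi> x = 0"
  shows "set_integrable lebesgue U (\<lambda>x. f x * \<phi> x)"
proof -
  have "compact (\<phi> ` K)"
    using K continuous_on_subset[OF cont] by (intro compact_continuous_image) auto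
  then obtain B where B: "\<And>x. x \<in> K \<Longrightarrow> \<bar>\<phi> x\<bar> \<le> B"
    using compact_imp_bounded bounded_iff by (metis image_eqI real_norm_def)
  have fK: "integrable lebesgue (\<lambda>x. indicator K x *\<^sub>R f x)"
    using f K unfolding locally_integrable_def set_integrable_def by blast
  have "integrable lebesgue (\<lambda>x. \<phi> x * (indicator K x *\<^sub>R f x))"
  proof (rule Bochner_Integration.integrable_bound)
    show "integrable lebesgue (\<lambda>x. B * (indicator K x *\<^sub>R f x))"
      using fK by simp
    show "(\<lambda>x. \<phi> x * (indicator K x *\<^sub>R f x)) \<in> borel_measurable lebesgue"
      using borel_measurable_integrable[OF fK] borel_measurable_continuous_onI[OF cont]
      by (intro borel_measurable_times) (auto intro: measurable_completion)
    show "AE x in lebesgue. norm (\<phi> x * (indicator K x *\<^sub>R f x)) \<le> norm (B * (indicator K x *\<^sub>R f x))"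
    proof (rule AE_I2)
      fix x
      show "norm (\<phi> x * (indicator K x *\<^sub>R f x)) \<le> norm (B * (indicator K x *\<^sub>R f x))"
        using B[of x] by (cases "x \<in> K") (auto simp: abs_mult intro!: mult_right_mono)
    qed
  qed
  also have "(\<lambda>x. \<phi> x * (indicator K x *\<^sub>R f x)) = (\<lambda>x. indicator U x *\<^sub>R (f x * \<phi> x))"
    using K supp by (auto simp: indicator_def fun_eq_iff)
  finally show ?thesis unfolding set_integrable_def .
qed

lemma bump_continuous: "d > 0 \<Longrightarrow> p \<in> Pol n \<Longrightarrow> continuous_on S (bump d a p)"
  by (meson bump_differentiable continuous_at_imp_continuous_on differentiable_imp_continuous_within)

lemma bump_eq_0: "x \<notin> cball 0 (sqrt (1 - d)) \<Longrightarrow> bump d a p x = 0"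
  unfolding bump_def cutoff_def using real_le_rsqrt[of "norm x" "1 - d"] by auto

lemma bump_integrable:
  fixes f :: "real^'n \<Rightarrow> real"
  assumes "locally_integrable (ball 0 1) f" "0 < d" "d < 1" "p \<in> Pol n"
  shows "integrable lebesgue_ball (\<lambda>x. f x * bump d a p x)"
  unfolding set_integrable_lebesgue_on[symmetric]
  by (rule locally_integrable_mult_continuous[OF assms(1), of "cball 0 (sqrt (1 - d))"])
    (use assms bump_continuous in \<open>auto simp: cball_subset_ball_iff bump_eq_0\<close>)

lemma weak_partial_bump:
  fixes f :: "real^'n \<Rightarrow> real"
  assumes w: "has_weak_partial i f g" and d: "0 < d" "d < 1" and p: "p \<in> Pol n"
  shows "(\<integral>x. f x * (bump d a (pd i p) x - 2 * a * bump d (a - 1) (\<lambda>x. x $ i * p x) x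
      - 2 * d * bump d (a - 2) (\<lambda>x. x $ i * p x) x) \<partial>lebesgue_ball)
    = - (\<integral>x. g x * bump d a p x \<partial>lebesgue_ball)"
proof -
  have "(LINT x:ball 0 1|lebesgue. f x * pd i (bump d a p) x) = - (LINT x:ball 0 1|lebesgue. g x * bump d a p x)"
    using w bump_test_function[OF d p] unfolding has_weak_partial_def by blast
  then show ?thesis
    unfolding set_integral_lebesgue_on pd_bump[OF d(1) p] .
qed

text \<open>The double \<open>Suc\<close> keeps every term strictly below 1, as
  \<open>bump_test_function\<close> requires.\<close>

definition dseq :: "nat \<Rightarrow> real" where "dseq n = inverse (real (Suc (Suc n)))"

lemma dseq: "0 < dseq n" "dseq n < 1"
  by (auto simp: dseq_def inverse_less_1_iff)

lemma dseq_lim: "filterlim dseq (at_right 0) sequentially"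
  unfolding filterlim_at_right_to_0 filterlim_at dseq_def
  using LIMSEQ_Suc[OF LIMSEQ_inverse_real_of_nat] by (simp add: filterlim_at)

text \<open>The assumption \<open>mass\<close> includes integrability of the weight, because the integral of a
  non-integrable function is 0.\<close>

locale weighted_ball =
  fixes \<mu> :: real and M :: "(real^'n) measure"
  assumes mu: "\<mu> \<ge> 0" and M_def: "M = ballM \<mu>" and mass: "(\<integral>x. (1::real) \<partial>M) \<noteq> 0"
begin

abbreviation "sq \<equiv> square_integrable M"

lemma integrable_one: "integrable M (\<lambda>x. 1::real)"
  using mass not_integrable_integral_eq by blast

lemma sq_one: "sq (\<lambda>x. 1)"
  using integrable_one by (simp add: square_integrable_def)

lemma sq_bounded:
  assumes "h \<in> borel_measurable lebesgue_ball" "\<And>x. x \<in> ball 0 1 \<Longrightarrow> \<bar>h x\<bar> \<le> B"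
  shows "sq h"
  using square_integrable_bounded_mult[OF sq_one, of h B] assms by (simp add: M_def)

lemma sq_Pol: "p \<in> Pol n \<Longrightarrow> sq p"
  using Pol_bounded[of p n] sq_bounded Pol_measurable by metis

lemma sq_Pol_mult: "p \<in> Pol n \<Longrightarrow> sq f \<Longrightarrow> sq (\<lambda>x. p x * f x)"
  using Pol_bounded[of p n] square_integrable_bounded_mult[of M f p] Pol_measurable[of p n]
  by (metis M_def measurable_ballM space_ballM)

lemma sq_integrable: "sq f \<Longrightarrow> integrable M f"
  using square_integrable_mult[OF _ sq_one, of f] by simp

lemma sq_measurable: "sq f \<Longrightarrow> f \<in> borel_measurable lebesgue_ball"
  using square_integrable_measurable[of M f] by (simp add: M_def)

lemma sq_integrable_W: "sq f \<Longrightarrow> integrable lebesgue_ball (\<lambda>x. f x * W \<mu> x)"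
  using sq_integrable integrable_ballM[of f \<mu>] sq_measurable by (simp add: M_def)

lemma integral_M: "f \<in> borel_measurable lebesgue_ball \<Longrightarrow> integral\<^sup>L M f = (\<integral>x. f x * W \<mu> x \<partial>lebesgue_ball)"
  by (simp add: M_def integral_ballM)

text \<open>Applied with \<open>a = \<mu> + 1/2\<close> for radial and \<open>a = \<mu> - 1/2\<close> for tangential derivatives; the
  latter do not see the cutoff, so that \<open>bump d (a - 1)\<close> and \<open>bump d (a - 2)\<close> cancel.\<close>

lemma bump_limit:
  assumes f: "sq f" and p: "p \<in> Pol n" and a: "a \<ge> - 1/2" "a \<ge> \<mu> - 1/2"
  shows "(\<lambda>k. \<integral>x. f x * bump (dseq k) a p x \<partial>lebesgue_ball) \<longlonglongrightarrow> (\<integral>x. f x * (p x * (1 - (norm x)\<^sup>2) powr a) \<partial>lebesgue_ball)"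
    and "(\<lambda>k. \<integral>x. f x * (dseq k * bump (dseq k) (a - 1) p x) \<partial>lebesgue_ball) \<longlonglongrightarrow> 0"
proof -
  obtain B where B: "\<And>x. x \<in> ball 0 1 \<Longrightarrow> \<bar>p x\<bar> \<le> B"
    using Pol_bounded[OF p] by blast
  have n1: "(norm x)\<^sup>2 < 1" if "x \<in> ball 0 1" for x :: "real^'n"
    using that by (simp add: power_less_one_iff)
  have le: "(1 - (norm x)\<^sup>2) powr a \<le> W \<mu> x" if "x \<in> ball 0 1" for x :: "real^'n"
    unfolding W_def using n1[OF that] a by (intro powr_mono') auto
  note fm = sq_measurable[OF f]
  have bm: "bump (dseq k) c p \<in> borel_measurable lebesgue_ball" for k c
    by (intro continuous_measurable_ball bump_continuous[OF _ p] dseq)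
  have w: "integrable lebesgue_ball (\<lambda>x. 2 * B * \<bar>f x * W \<mu> x\<bar>)"
    using sq_integrable_W[OF f] by simp
  \<comment> \<open>One majorant serves both limits. The factor 2 is that of
    \<open>cutoff_le'\<close>, and the power with exponent a is at most \<open>W \<mu> x\<close>
    because its base lies in (0, 1] and a >= mu - 1/2.\<close>
  have bnd: "\<bar>f x * (p x * c)\<bar> \<le> 2 * B * \<bar>f x * W \<mu> x\<bar>" if x: "x \<in> ball 0 1" and c: "0 \<le> c" "c \<le> 2 * (1 - (norm x)\<^sup>2) powr a" for x c
  proof -
    have "\<bar>p x\<bar> * c \<le> B * (2 * W \<mu> x)"
      using B[OF x] c le[OF x] by (intro mult_mono) auto
    then have "\<bar>f x\<bar> * (\<bar>p x\<bar> * c) \<le> \<bar>f x\<bar> * (B * (2 * W \<mu> x))"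
      by (intro mult_left_mono) auto
    then show ?thesis using c by (simp add: abs_mult W_nonneg mult_ac)
  qed
  show "(\<lambda>k. \<integral>x. f x * bump (dseq k) a p x \<partial>lebesgue_ball) \<longlonglongrightarrow> (\<integral>x. f x * (p x * (1 - (norm x)\<^sup>2) powr a) \<partial>lebesgue_ball)"
  proof (rule integral_dominated_convergence[OF _ _ w])
    show "(\<lambda>x. f x * (p x * (1 - (norm x)\<^sup>2) powr a)) \<in> borel_measurable lebesgue_ball"
      by (intro borel_measurable_times fm Pol_measurable[OF p] measurable_lebesgue_onI[of "\<lambda>x. (1 - (norm x)\<^sup>2) powr a"]) measurable
    show "(\<lambda>x. f x * bump (dseq k) a p x) \<in> borel_measurable lebesgue_ball" for k
      using fm bm by measurable
    show "AE x in lebesgue_ball. (\<lambda>k. f x * bump (dseq k) a p x) \<longlonglongrightarrow> f x * (p x * (1 - (norm x)\<^sup>2) powr a)"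
      by (rule AE_I2) (auto simp: bump_def space_restrict_space n1
          intro!: tendsto_mult filterlim_compose[OF cutoff_tendsto dseq_lim])
    show "AE x in lebesgue_ball. norm (f x * bump (dseq k) a p x) \<le> 2 * B * \<bar>f x * W \<mu> x\<bar>" for k
    proof (rule AE_I2)
      fix x :: "real^'n" assume "x \<in> space lebesgue_ball"
      then have x: "x \<in> ball 0 1" by (simp add: space_restrict_space)
      have "cutoff (dseq k) a ((norm x)\<^sup>2) \<le> 2 * (1 - (norm x)\<^sup>2) powr a"
        using cutoff_le[OF dseq(1) a(1) n1[OF x], of k] powr_ge_zero[of "1 - (norm x)\<^sup>2" a] by linarith
      then show "norm (f x * bump (dseq k) a p x) \<le> 2 * B * \<bar>f x * W \<mu> x\<bar>"
        unfolding bump_def real_norm_def by (intro bnd[OF x] cutoff_nonneg)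
    qed
  qed
  \<comment> \<open>Pointwise \<open>dseq k\<close> tends to 0 while the bump has a finite limit;
    the limit is displayed as a product with 0 so that it matches
    \<open>tendsto_mult\<close>.\<close>
  have "(\<lambda>k. \<integral>x. f x * (dseq k * bump (dseq k) (a - 1) p x) \<partial>lebesgue_ball) \<longlonglongrightarrow> (\<integral>x. f x * (0 * (p x * (1 - (norm x)\<^sup>2) powr (a - 1))) \<partial>lebesgue_ball)"
  proof (rule integral_dominated_convergence[OF _ _ w])
    show "(\<lambda>x. f x * (0 * (p x * (1 - (norm x)\<^sup>2) powr (a - 1)))) \<in> borel_measurable lebesgue_ball"
      by simp
    show "(\<lambda>x. f x * (dseq k * bump (dseq k) (a - 1) p x)) \<in> borel_measurable lebesgue_ball" for k
      using fm bm by measurable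
    have "dseq \<longlonglongrightarrow> 0" using dseq_lim by (simp add: filterlim_at)
    then show "AE x in lebesgue_ball. (\<lambda>k. f x * (dseq k * bump (dseq k) (a - 1) p x)) \<longlonglongrightarrow> f x * (0 * (p x * (1 - (norm x)\<^sup>2) powr (a - 1)))"
      by (intro AE_I2 tendsto_mult tendsto_const) (auto simp: bump_def space_restrict_space n1
          intro!: tendsto_mult filterlim_compose[OF cutoff_tendsto dseq_lim])
    show "AE x in lebesgue_ball. norm (f x * (dseq k * bump (dseq k) (a - 1) p x)) \<le> 2 * B * \<bar>f x * W \<mu> x\<bar>" for k
    proof (rule AE_I2)
      fix x :: "real^'n" assume "x \<in> space lebesgue_ball"
      then have x: "x \<in> ball 0 1" by (simp add: space_restrict_space)
      have "\<bar>f x * (p x * (dseq k * cutoff (dseq k) (a - 1) ((norm x)\<^sup>2)))\<bar> \<le> 2 * B * \<bar>f x * W \<mu> x\<bar>"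
        using dseq(1)[of k] by (intro bnd[OF x] cutoff_le' a n1[OF x] mult_nonneg_nonneg cutoff_nonneg) auto
      then show "norm (f x * (dseq k * bump (dseq k) (a - 1) p x)) \<le> 2 * B * \<bar>f x * W \<mu> x\<bar>"
        unfolding bump_def real_norm_def by (simp only: mult.left_commute)
    qed
  qed
  then show "(\<lambda>k. \<integral>x. f x * (dseq k * bump (dseq k) (a - 1) p x) \<partial>lebesgue_ball) \<longlonglongrightarrow> 0" by simp
qed

text \<open>Testing with exponent mu + 1/2 imitates a polynomial times the weight at mu + 1, whose
  i-th derivative contains -(2 mu + 1) x_i times the weight at mu. The term left by the exponential
  carries a factor \<open>dseq k\<close> and vanishes by the second part of
  \<open>bump_limit\<close>.\<close>

lemma ibp_radial:
  assumes f: "sq f" and g: "sq g" and w: "has_weak_partial i f g" and p: "p \<in> Pol n"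
  shows "(\<integral>x. g x * (p x * (1 - (norm x)\<^sup>2)) \<partial>M)
    = - (\<integral>x. f x * (pd i p x * (1 - (norm x)\<^sup>2) - (2 * \<mu> + 1) * (x $ i * p x)) \<partial>M)"
proof -
  let ?a = "\<mu> + 1/2"
  let ?q = "\<lambda>x. x $ i * p x"
  have li: "locally_integrable (ball 0 1) f" using w by (simp add: has_weak_partial_def)
  note I = bump_integrable[OF li dseq]
  note q = Pol_coord_mult[OF p, of i]
  have eq: "(\<integral>x. f x * bump (dseq k) ?a (pd i p) x \<partial>lebesgue_ball) - (2 * \<mu> + 1) * (\<integral>x. f x * bump (dseq k) (\<mu> - 1/2) ?q x \<partial>lebesgue_ball)
      - 2 * (\<integral>x. f x * (dseq k * bump (dseq k) (\<mu> - 1/2 - 1) ?q x) \<partial>lebesgue_ball) = - (\<integral>x. g x * bump (dseq k) ?a p x \<partial>lebesgue_ball)" for k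
  proof -
    have "(\<integral>x. f x * (bump (dseq k) ?a (pd i p) x - 2 * ?a * bump (dseq k) (?a - 1) ?q x
      - 2 * dseq k * bump (dseq k) (?a - 2) ?q x) \<partial>lebesgue_ball) =
      (\<integral>x. f x * bump (dseq k) ?a (pd i p) x - (2 * \<mu> + 1) * (f x * bump (dseq k) (\<mu> - 1/2) ?q x)
      - 2 * (dseq k * (f x * bump (dseq k) (\<mu> - 1/2 - 1) ?q x)) \<partial>lebesgue_ball)"
      by (intro Bochner_Integration.integral_cong) (simp_all add: algebra_simps)
    also have "\<dots> = (\<integral>x. f x * bump (dseq k) ?a (pd i p) x \<partial>lebesgue_ball) - (2 * \<mu> + 1) * (\<integral>x. f x * bump (dseq k) (\<mu> - 1/2) ?q x \<partial>lebesgue_ball)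
      - 2 * (dseq k * (\<integral>x. f x * bump (dseq k) (\<mu> - 1/2 - 1) ?q x \<partial>lebesgue_ball))"
      by (simp add: I[OF Pol_pd[OF p]] I[OF q])
    finally show ?thesis
      unfolding weak_partial_bump[OF w dseq p]
      by (simp add: mult.left_commute[of _ "dseq k"])
  qed
  have "(\<lambda>k. (\<integral>x. f x * bump (dseq k) ?a (pd i p) x \<partial>lebesgue_ball) - (2 * \<mu> + 1) * (\<integral>x. f x * bump (dseq k) (\<mu> - 1/2) ?q x \<partial>lebesgue_ball)
      - 2 * (\<integral>x. f x * (dseq k * bump (dseq k) (\<mu> - 1/2 - 1) ?q x) \<partial>lebesgue_ball)) \<longlonglongrightarrow>
     (\<integral>x. f x * (pd i p x * (1 - (norm x)\<^sup>2) powr ?a) \<partial>lebesgue_ball) - (2 * \<mu> + 1) * (\<integral>x. f x * (?q x * (1 - (norm x)\<^sup>2) powr (\<mu> - 1/2)) \<partial>lebesgue_ball) - 2 * 0"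
    by (intro tendsto_diff tendsto_mult tendsto_const bump_limit[OF f Pol_pd[OF p]] bump_limit[OF f q]) (use mu in auto)
  moreover have "(\<lambda>k. - (\<integral>x. g x * bump (dseq k) ?a p x \<partial>lebesgue_ball)) \<longlonglongrightarrow> - (\<integral>x. g x * (p x * (1 - (norm x)\<^sup>2) powr ?a) \<partial>lebesgue_ball)"
    by (intro tendsto_minus bump_limit[OF g p]) (use mu in auto)
  ultimately have L: "(\<integral>x. f x * (pd i p x * (1 - (norm x)\<^sup>2) powr ?a) \<partial>lebesgue_ball)
     - (2 * \<mu> + 1) * (\<integral>x. f x * (?q x * (1 - (norm x)\<^sup>2) powr (\<mu> - 1/2)) \<partial>lebesgue_ball)
     = - (\<integral>x. g x * (p x * (1 - (norm x)\<^sup>2) powr ?a) \<partial>lebesgue_ball)"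
    unfolding eq using LIMSEQ_unique by fastforce
  have Wa: "(1 - (norm x)\<^sup>2) powr ?a = (1 - (norm x)\<^sup>2) * W \<mu> x" if "x \<in> ball 0 1" for x :: "real^'n"
  proof -
    have "(norm x)\<^sup>2 < 1" using that by (simp add: power_less_one_iff)
    then show ?thesis by (simp add: W_def powr_mult_base add.commute)
  qed
  have r: "(\<lambda>x::real^'n. 1 - (norm x)\<^sup>2) \<in> borel_measurable lebesgue_ball"
    by (intro measurable_lebesgue_onI) measurable
  have b1: "\<bar>1 - (norm x)\<^sup>2\<bar> \<le> 1" if "x \<in> ball 0 1" for x :: "real^'n"
    using that by (simp add: abs_le_iff power_le_one)
  have s1: "sq (\<lambda>x. (1 - (norm x)\<^sup>2) * (pd i p x * f x))"
    by (rule square_integrable_bounded_mult[OF sq_Pol_mult[OF Pol_pd[OF p] f], of _ 1]) (use r b1 in \<open>auto simp: M_def\<close>)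
  have s2: "sq (\<lambda>x. ?q x * f x)" by (rule sq_Pol_mult[OF q f])
  have m: "(\<lambda>x. g x * (p x * (1 - (norm x)\<^sup>2))) \<in> borel_measurable lebesgue_ball"
    "(\<lambda>x. f x * (pd i p x * (1 - (norm x)\<^sup>2) - (2 * \<mu> + 1) * (x $ i * p x))) \<in> borel_measurable lebesgue_ball"
    using r sq_measurable[OF g] sq_measurable[OF f] Pol_measurable[OF p] Pol_measurable[OF q] Pol_measurable[OF Pol_pd[OF p]]
    by measurable
  have "(\<integral>x. g x * (p x * (1 - (norm x)\<^sup>2)) \<partial>M) = (\<integral>x. g x * (p x * (1 - (norm x)\<^sup>2) powr ?a) \<partial>lebesgue_ball)"
    unfolding integral_M[OF m(1)]
    by (intro Bochner_Integration.integral_cong) (auto simp: space_restrict_space Wa)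
  moreover have "(\<integral>x. f x * (pd i p x * (1 - (norm x)\<^sup>2) - (2 * \<mu> + 1) * (x $ i * p x)) \<partial>M) =
     (\<integral>x. f x * (pd i p x * (1 - (norm x)\<^sup>2) powr ?a) \<partial>lebesgue_ball)
     - (2 * \<mu> + 1) * (\<integral>x. f x * (?q x * (1 - (norm x)\<^sup>2) powr (\<mu> - 1/2)) \<partial>lebesgue_ball)"
  proof -
    have i1: "integrable lebesgue_ball (\<lambda>x. f x * (pd i p x * (1 - (norm x)\<^sup>2) powr ?a))"
    proof -
      have "integrable lebesgue_ball (\<lambda>x. f x * (pd i p x * (1 - (norm x)\<^sup>2) powr ?a))
        \<longleftrightarrow> integrable lebesgue_ball (\<lambda>x. (1 - (norm x)\<^sup>2) * (pd i p x * f x) * W \<mu> x)"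
        by (intro Bochner_Integration.integrable_cong) (auto simp: space_restrict_space Wa)
      then show ?thesis using sq_integrable_W[OF s1] by blast
    qed
    have i2: "integrable lebesgue_ball (\<lambda>x. f x * (?q x * (1 - (norm x)\<^sup>2) powr (\<mu> - 1/2)))"
      using sq_integrable_W[OF s2] by (simp add: W_def mult_ac)
    show ?thesis
      unfolding integral_M[OF m(2)] integral_mult_right_zero[symmetric]
      by (subst Bochner_Integration.integral_diff[symmetric, OF i1 integrable_mult_right[OF i2]])
       (intro Bochner_Integration.integral_cong; auto simp: space_restrict_space Wa W_def algebra_simps)
  qed
  ultimately show ?thesis using L by simp
qed

text \<open>Rotation fields annihilate functions of |x|. Testing d_i with x_j p and d_j with x_i p
  produces the same derivative of the cutoff, with factor x_i x_j p, and the two copies cancel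
  before the limit. Only bumps of exponent mu - 1/2 remain, whose limit carries the weight
  itself.\<close>

lemma ibp_tangential:
  assumes f: "sq f" and g: "sq g" "sq h" and w: "has_weak_partial i f g" "has_weak_partial j f h" and p: "p \<in> Pol n"
  shows "(\<integral>x. (x $ j * g x - x $ i * h x) * p x \<partial>M) = - (\<integral>x. f x * (x $ j * pd i p x - x $ i * pd j p x) \<partial>M)"
proof -
  let ?a = "\<mu> - 1/2"
  let ?q = "\<lambda>x. x $ i * (x $ j * p x)"
  let ?r = "\<lambda>x. x $ j * pd i p x - x $ i * pd j p x"
  let ?F = "\<lambda>k i s x. bump (dseq k) ?a (pd i s) x - 2 * ?a * bump (dseq k) (?a - 1) ?q x
      - 2 * dseq k * bump (dseq k) (?a - 2) ?q x"
  have li: "locally_integrable (ball 0 1) f" using w by (simp add: has_weak_partial_def)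
  note I = bump_integrable[OF li dseq]
  note pi = Pol_coord_mult[OF p, of i] and pj = Pol_coord_mult[OF p, of j]
  have q: "?q \<in> Pol (Suc (Suc n))" by (rule Pol_coord_mult[OF pj])
  have r: "?r \<in> Pol (Suc n)"
    by (intro lspan_diff Pol_coord_mult Pol_pd p)
  have eq: "(\<integral>x. f x * bump (dseq k) ?a ?r x \<partial>lebesgue_ball) =
    - ((\<integral>x. g x * bump (dseq k) ?a (\<lambda>x. x $ j * p x) x \<partial>lebesgue_ball) - (\<integral>x. h x * bump (dseq k) ?a (\<lambda>x. x $ i * p x) x \<partial>lebesgue_ball))" for k
  proof -
    have int: "integrable lebesgue_ball (\<lambda>x. f x * ?F k l s x)" if "s \<in> Pol (Suc n)" for l s
    proof -
      have "(\<lambda>x. f x * ?F k l s x) = (\<lambda>x. f x * bump (dseq k) ?a (pd l s) x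
        - (2 * ?a) * (f x * bump (dseq k) (?a - 1) ?q x) - (2 * dseq k) * (f x * bump (dseq k) (?a - 2) ?q x))"
        by (simp add: fun_eq_iff right_diff_distrib mult.left_commute)
      then show ?thesis
        by (simp only:) (intro Bochner_Integration.integrable_diff integrable_mult_right I[OF Pol_pd[OF that]] I[OF q])
    qed
    have "(\<integral>x. f x * bump (dseq k) ?a ?r x \<partial>lebesgue_ball) =
      (\<integral>x. f x * ?F k i (\<lambda>x. x $ j * p x) x - f x * ?F k j (\<lambda>x. x $ i * p x) x \<partial>lebesgue_ball)"
      unfolding bump_def pd_coord_mult[OF Pol_differentiable[OF p]]
      by (intro Bochner_Integration.integral_cong refl) (auto simp: algebra_simps)
    also have "\<dots> = (\<integral>x. f x * ?F k i (\<lambda>x. x $ j * p x) x \<partial>lebesgue_ball) - (\<integral>x. f x * ?F k j (\<lambda>x. x $ i * p x) x \<partial>lebesgue_ball)"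
      by (rule Bochner_Integration.integral_diff[OF int[OF pj] int[OF pi]])
    also have "(\<integral>x. f x * ?F k i (\<lambda>x. x $ j * p x) x \<partial>lebesgue_ball) = - (\<integral>x. g x * bump (dseq k) ?a (\<lambda>x. x $ j * p x) x \<partial>lebesgue_ball)"
      by (rule weak_partial_bump[OF w(1) dseq pj])
    also have "(\<integral>x. f x * ?F k j (\<lambda>x. x $ i * p x) x \<partial>lebesgue_ball) = - (\<integral>x. h x * bump (dseq k) ?a (\<lambda>x. x $ i * p x) x \<partial>lebesgue_ball)"
      using weak_partial_bump[OF w(2) dseq pi, of k ?a] by (simp only: mult.left_commute[of "_ $ j"])
    finally show ?thesis by simp
  qed
  have a: "?a \<ge> - 1/2" "?a \<ge> \<mu> - 1/2" using mu by auto
  have "(\<lambda>k. \<integral>x. f x * bump (dseq k) ?a ?r x \<partial>lebesgue_ball) \<longlonglongrightarrow> (\<integral>x. f x * (?r x * (1 - (norm x)\<^sup>2) powr ?a) \<partial>lebesgue_ball)"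
    by (rule bump_limit[OF f r a])
  moreover have "(\<lambda>k. \<integral>x. f x * bump (dseq k) ?a ?r x \<partial>lebesgue_ball) \<longlonglongrightarrow>
    - ((\<integral>x. g x * ((x $ j * p x) * (1 - (norm x)\<^sup>2) powr ?a) \<partial>lebesgue_ball) - (\<integral>x. h x * ((x $ i * p x) * (1 - (norm x)\<^sup>2) powr ?a) \<partial>lebesgue_ball))"
    unfolding eq by (intro tendsto_minus tendsto_diff bump_limit[OF g(1) pj a] bump_limit[OF g(2) pi a])
  ultimately have L: "(\<integral>x. f x * (?r x * W \<mu> x) \<partial>lebesgue_ball) =
    - ((\<integral>x. g x * ((x $ j * p x) * W \<mu> x) \<partial>lebesgue_ball) - (\<integral>x. h x * ((x $ i * p x) * W \<mu> x) \<partial>lebesgue_ball))"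
    unfolding W_def by (rule LIMSEQ_unique)
  have i1: "integrable M (\<lambda>x. (x $ j * p x) * g x)" "integrable M (\<lambda>x. (x $ i * p x) * h x)"
    using sq_integrable sq_Pol_mult[OF pj g(1)] sq_Pol_mult[OF pi g(2)] by blast+
  have "(\<integral>x. (x $ j * g x - x $ i * h x) * p x \<partial>M) = (\<integral>x. (x $ j * p x) * g x - (x $ i * p x) * h x \<partial>M)"
    by (intro Bochner_Integration.integral_cong) (auto simp: algebra_simps)
  also have "\<dots> = (\<integral>x. (x $ j * p x) * g x \<partial>M) - (\<integral>x. (x $ i * p x) * h x \<partial>M)"
    using i1 by simp
  also have "\<dots> = (\<integral>x. (x $ j * p x) * g x * W \<mu> x \<partial>lebesgue_ball) - (\<integral>x. (x $ i * p x) * h x * W \<mu> x \<partial>lebesgue_ball)"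
    using sq_measurable[OF sq_Pol_mult[OF pj g(1)]] sq_measurable[OF sq_Pol_mult[OF pi g(2)]]
    by (simp only: integral_M)
  also have "\<dots> = - (\<integral>x. f x * (?r x * W \<mu> x) \<partial>lebesgue_ball)"
    unfolding L by (simp add: mult_ac)
  also have "(\<integral>x. f x * (?r x * W \<mu> x) \<partial>lebesgue_ball) = (\<integral>x. f x * ?r x \<partial>M)"
    using sq_measurable[OF sq_Pol_mult[OF r f]] by (subst integral_M) (simp_all add: mult_ac)
  finally show ?thesis .
qed

end

section \<open>Polynomials as weakly differentiable functions\<close>

lemma continuous_locally_integrable:
  fixes f :: "real^'n \<Rightarrow> real"
  assumes "continuous_on UNIV f"
  shows "locally_integrable U f"
  unfolding locally_integrable_def set_integrable_def
proof (intro allI impI)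
  fix K :: "(real^'n) set" assume "compact K \<and> K \<subseteq> U"
  then have "integrable lborel (\<lambda>x. indicator K x *\<^sub>R f x)"
    using continuous_on_subset[OF assms] by (intro borel_integrable_compact) auto
  then show "integrable lebesgue (\<lambda>x. indicator K x *\<^sub>R f x)"
    by (simp add: integrable_completion borel_measurable_integrable)
qed

lemma pd_eq_0_outside_support:
  assumes "x \<notin> closure {x. \<phi> x \<noteq> 0}"
  shows "pd i \<phi> x = 0"
proof -
  have "(\<phi> has_derivative (\<lambda>h. 0)) (at x)"
    by (rule has_derivative_transform_within_open[of "\<lambda>x. 0" _ x UNIV "- closure {x. \<phi> x \<noteq> 0}"])
      (use assms closure_subset[of "{x. \<phi> x \<noteq> 0}"] in auto)
  then show ?thesis by (simp add: pd_eqI)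
qed

text \<open>The product of p with a test function has compact support, so each of its partial
  derivatives integrates to 0, and the product rule gives the claim. This lets \<open>green\<close>
  be applied with a polynomial in the place of f.\<close>

lemma Pol_has_weak_partial:
  fixes p :: "real^'n \<Rightarrow> real"
  assumes p: "p \<in> Pol n"
  shows "has_weak_partial i p (pd i p)"
  unfolding has_weak_partial_def
proof (intro conjI allI impI)
  show "locally_integrable (ball 0 1) p" "locally_integrable (ball 0 1) (pd i p)"
    using Pol_continuous[OF p] Pol_continuous[OF Pol_pd[OF p]] by (auto intro: continuous_locally_integrable)
  fix \<phi> :: "real^'n \<Rightarrow> real" assume t: "test_function (ball 0 1) \<phi>"
  let ?S = "closure {x. \<phi> x \<noteq> 0}"
  have S: "compact ?S" "?S \<subseteq> ball 0 1" and sm: "smooth \<phi>"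
    using t by (auto simp: test_function_def)
  have d: "\<phi> differentiable (at x)" "pd i \<phi> differentiable (at x)" for x
    using sm[unfolded smooth_def, rule_format, of "[]"] sm[unfolded smooth_def, rule_format, of "[i]"] by auto
  have c: "continuous_on UNIV \<phi>" "continuous_on UNIV (pd i \<phi>)"
    by (meson d continuous_at_imp_continuous_on differentiable_imp_continuous_within)+
  let ?\<psi> = "\<lambda>x. p x * \<phi> x"
  have e: "pd i ?\<psi> = (\<lambda>x. pd i p x * \<phi> x + p x * pd i \<phi> x)"
    by (rule ext) (rule pd_mult[OF Pol_differentiable[OF p] d(1)])
  have z: "\<phi> x = 0" "pd i \<phi> x = 0" if "x \<notin> ?S" for x
    using that closure_subset[of "{x. \<phi> x \<noteq> 0}"] pd_eq_0_outside_support[OF that] by auto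
  have I: "set_integrable lebesgue (ball 0 1) (\<lambda>x. p x * pd i \<phi> x)"
    "set_integrable lebesgue (ball 0 1) (\<lambda>x. pd i p x * \<phi> x)"
    using locally_integrable_mult_continuous[OF continuous_locally_integrable[OF Pol_continuous[OF p]] S _ c(2) z(2)]
      locally_integrable_mult_continuous[OF continuous_locally_integrable[OF Pol_continuous[OF Pol_pd[OF p]]] S _ c(1) z(1)]
    by simp_all
  have "(\<integral>x. pd i ?\<psi> x \<partial>lborel) = 0"
  proof (rule integral_partial_eq_0[where R = 1])
    show "?\<psi> differentiable (at x)" for x
      using Pol_differentiable[OF p] d by simp
    show "continuous_on UNIV (pd i ?\<psi>)"
      unfolding e by (intro continuous_intros Pol_continuous[OF p] Pol_continuous[OF Pol_pd[OF p]] c)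
    show "?\<psi> x = 0" if "x \<notin> cball 0 1" for x
    proof -
      have "x \<notin> ?S" using S(2) that by auto
      from z(1)[OF this] show ?thesis by (simp only: mult_zero_right)
    qed
  qed
  then have "0 = (\<integral>x. pd i ?\<psi> x \<partial>lebesgue)"
  proof (subst integral_completion)
    show "pd i ?\<psi> \<in> borel_measurable lborel"
      unfolding e using borel_measurable_continuous_onI[OF Pol_continuous[OF p]]
        borel_measurable_continuous_onI[OF Pol_continuous[OF Pol_pd[OF p]]] c[THEN borel_measurable_continuous_onI]
      by simp
  qed simp
  also have "\<dots> = (LINT x:ball 0 1|lebesgue. p x * pd i \<phi> x + pd i p x * \<phi> x)"
    unfolding set_lebesgue_integral_def
  proof (intro Bochner_Integration.integral_cong refl)
    fix x
    show "pd i ?\<psi> x = indicator (ball 0 1) x *\<^sub>R (p x * pd i \<phi> x + pd i p x * \<phi> x)"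
    proof (cases "x \<in> ?S")
      case True
      then have "x \<in> ball 0 1" using S(2) by blast
      then show ?thesis by (simp add: e)
    next
      case False
      show ?thesis unfolding e z(1)[OF False] z(2)[OF False] by simp
    qed
  qed
  also have "\<dots> = (LINT x:ball 0 1|lebesgue. p x * pd i \<phi> x) + (LINT x:ball 0 1|lebesgue. pd i p x * \<phi> x)"
    using I by simp
  finally show "(LINT x:ball 0 1|lebesgue. p x * pd i \<phi> x) = - (LINT x:ball 0 1|lebesgue. pd i p x * \<phi> x)"
    by simp
qed

section \<open>The Dirichlet form density and Green's identity\<close>

definition pgrad :: "(real^'n \<Rightarrow> real) \<Rightarrow> real^'n \<Rightarrow> real^'n" where
  "pgrad p x = (\<chi> i. pd i p x)"

text \<open>The density of the energy with respect to \<open>W \<mu>\<close>: by Lagrange's identity it equals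
  \<open>(1 - |x|^2) (v \<bullet> w)\<close> plus the sum over \<open>i < j\<close> of
  \<open>(x_i v_j - x_j v_i) (x_i w_j - x_j w_i)\<close>.\<close>

definition gam :: "real^'n \<Rightarrow> real^'n \<Rightarrow> real^'n \<Rightarrow> real" where
  "gam x v w = v \<bullet> w - (x \<bullet> v) * (x \<bullet> w)"

lemma gam_nonneg:
  assumes "x \<in> ball 0 1"
  shows "gam x v v \<ge> 0"
proof -
  have "(x \<bullet> v)\<^sup>2 \<le> (x \<bullet> x) * (v \<bullet> v)" by (rule Cauchy_Schwarz_ineq)
  also have "\<dots> \<le> 1 * (v \<bullet> v)"
    using assms by (intro mult_right_mono) (auto simp: dot_square_norm power_le_one)
  finally show ?thesis by (simp add: gam_def power2_eq_square)
qed

lemma gam_commute: "gam x v w = gam x w v"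
  by (simp add: gam_def inner_commute mult.commute)

lemma gam_lin: "gam x (u + c *\<^sub>R v) w = gam x u w + c * gam x v w"
  by (simp add: gam_def inner_simps algebra_simps)

text \<open>The double sum is left unsymmetrized: its summands have exactly the shape of
  \<open>ibp_tangential\<close> with x_j w_i as the polynomial, and no order on the indices
  enters.\<close>

lemma gam_coords:
  "gam x v w = (\<Sum>i\<in>UNIV. v $ i * (w $ i * (1 - (norm x)\<^sup>2)))
    + (\<Sum>i\<in>UNIV. \<Sum>j\<in>UNIV. (x $ j * v $ i - x $ i * v $ j) * (x $ j * w $ i))"
proof -
  have "(\<Sum>i\<in>UNIV. \<Sum>j\<in>UNIV. (x $ j * v $ i - x $ i * v $ j) * (x $ j * w $ i))
    = (\<Sum>i\<in>UNIV. \<Sum>j\<in>UNIV. (x $ j * x $ j) * (v $ i * w $ i)) - (\<Sum>i\<in>UNIV. \<Sum>j\<in>UNIV. (x $ i * w $ i) * (x $ j * v $ j))"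
    by (simp add: sum_subtractf[symmetric] algebra_simps)
  also have "\<dots> = (norm x)\<^sup>2 * (v \<bullet> w) - (x \<bullet> w) * (x \<bullet> v)"
    by (subst sum.swap, simp add: power2_norm_eq_inner inner_vec_def sum_product)
  finally show ?thesis
    by (simp add: gam_def inner_vec_def sum_distrib_left algebra_simps sum_subtractf)
qed

context weighted_ball
begin

text \<open>The field g is a parameter and not the chosen \<open>weak_partial\<close>, so that both
  \<open>grad f\<close> and \<open>pgrad p\<close> qualify.\<close>

definition weakly :: "(real^'n \<Rightarrow> real) \<Rightarrow> (real^'n \<Rightarrow> real^'n) \<Rightarrow> bool" where
  "weakly f g \<longleftrightarrow> sq f \<and> (\<forall>i. sq (\<lambda>x. g x $ i) \<and> has_weak_partial i f (\<lambda>x. g x $ i))"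

lemma weakly_Pol: "p \<in> Pol n \<Longrightarrow> weakly p (pgrad p)"
  using sq_Pol Pol_pd Pol_has_weak_partial by (simp add: weakly_def pgrad_def) blast

lemma sq_coord: "sq f \<Longrightarrow> sq (\<lambda>x. x $ i * f x)"
  by (rule sq_Pol_mult[OF Pol_coord])

lemma sq_one_minus_norm: "sq f \<Longrightarrow> sq (\<lambda>x. f x * (1 - (norm x)\<^sup>2))"
proof -
  assume f: "sq f"
  have "sq (\<lambda>x. (1 - (norm x)\<^sup>2) * f x)"
  proof (rule square_integrable_bounded_mult[OF f, of _ 1])
    have "(\<lambda>x::real^'n. 1 - (norm x)\<^sup>2) \<in> borel_measurable lebesgue_ball"
      by (intro measurable_lebesgue_onI) measurable
    then show "(\<lambda>x. 1 - (norm x)\<^sup>2) \<in> borel_measurable M" by (simp add: M_def)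
    show "\<bar>1 - (norm x)\<^sup>2\<bar> \<le> 1" if "x \<in> space M" for x
      using that by (simp add: M_def abs_le_iff power_le_one)
  qed
  then show ?thesis by (simp only: mult.commute)
qed

lemma gam_integrable:
  assumes "\<And>i. sq (\<lambda>x. g x $ i)" "\<And>i. sq (\<lambda>x. h x $ i)"
  shows "integrable M (\<lambda>x. gam x (g x) (h x))"
  unfolding gam_def inner_vec_def inner_real_def
  by (intro Bochner_Integration.integrable_diff Bochner_Integration.integrable_sum square_integrable_mult
      square_integrable_sum sq_coord assms finite)

text \<open>Each summand of \<open>gam_coords\<close> is integrated by parts, the radial ones
  against d_i p and the tangential ones against x_j d_i p. All new derivatives fall on p, so first
  weak derivatives of f suffice.\<close>

lemma green:
  assumes f: "weakly f g" and p: "p \<in> Pol n"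
  shows "(\<integral>x. gam x (g x) (pgrad p x) \<partial>M) = - (\<integral>x. f x * ball_op \<mu> p x \<partial>M)"
proof -
  have sf: "sq f" and sg: "\<And>i. sq (\<lambda>x. g x $ i)" and w: "\<And>i. has_weak_partial i f (\<lambda>x. g x $ i)"
    using f by (auto simp: weakly_def)
  note P1 = Pol_pd[OF p] and P2 = Pol_pd[OF Pol_pd[OF p]] and P3 = Pol_coord_mult[OF Pol_pd[OF p]]
  let ?R = "\<lambda>i x. pd i (pd i p) x * (1 - (norm x)\<^sup>2) - (2 * \<mu> + 1) * (x $ i * pd i p x)"
  let ?T = "\<lambda>i j x. x $ j * pd i (\<lambda>x. x $ j * pd i p x) x - x $ i * pd j (\<lambda>x. x $ j * pd i p x) x"
  have sR: "sq (?R i)" for i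
    by (intro square_integrable_diff square_integrable_scale sq_one_minus_norm sq_Pol[OF P2] sq_coord sq_Pol[OF P1])
  have sT: "sq (?T i j)" for i j
    by (intro square_integrable_diff sq_coord sq_Pol[OF Pol_pd[OF P3]])
  have "(\<integral>x. gam x (g x) (pgrad p x) \<partial>M) =
    (\<integral>x. (\<Sum>i\<in>UNIV. g x $ i * (pd i p x * (1 - (norm x)\<^sup>2)))
    + (\<Sum>i\<in>UNIV. \<Sum>j\<in>UNIV. (x $ j * g x $ i - x $ i * g x $ j) * (x $ j * pd i p x)) \<partial>M)"
    by (simp add: gam_coords pgrad_def)
  also have "\<dots> = (\<Sum>i\<in>UNIV. \<integral>x. g x $ i * (pd i p x * (1 - (norm x)\<^sup>2)) \<partial>M)
    + (\<Sum>i\<in>UNIV. \<Sum>j\<in>UNIV. \<integral>x. (x $ j * g x $ i - x $ i * g x $ j) * (x $ j * pd i p x) \<partial>M)"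
  proof -
    have "integrable M (\<lambda>x. g x $ i * (pd i p x * (1 - (norm x)\<^sup>2)))" for i
      by (intro square_integrable_mult sg sq_one_minus_norm sq_Pol[OF P1])
    moreover have "integrable M (\<lambda>x. (x $ j * g x $ i - x $ i * g x $ j) * (x $ j * pd i p x))" for i j
      by (intro square_integrable_mult square_integrable_diff sg sq_coord sq_Pol[OF P1])
    ultimately show ?thesis
      by (simp add: Bochner_Integration.integral_add Bochner_Integration.integral_sum)
  qed
  also have "\<dots> = (\<Sum>i\<in>UNIV. - (\<integral>x. f x * ?R i x \<partial>M)) + (\<Sum>i\<in>UNIV. \<Sum>j\<in>UNIV. - (\<integral>x. f x * ?T i j x \<partial>M))"
    by (intro arg_cong2[of _ _ _ _ "(+)"] sum.cong refl ibp_radial[OF sf sg w P1] ibp_tangential[OF sf sg sg w w P3])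
  also have "\<dots> = - (\<integral>x. (\<Sum>i\<in>UNIV. f x * ?R i x) + (\<Sum>i\<in>UNIV. \<Sum>j\<in>UNIV. f x * ?T i j x) \<partial>M)"
    using square_integrable_mult[OF sf sR] square_integrable_mult[OF sf sT]
    by (simp add: Bochner_Integration.integral_add Bochner_Integration.integral_sum sum_negf)
  also have "(\<integral>x. (\<Sum>i\<in>UNIV. f x * ?R i x) + (\<Sum>i\<in>UNIV. \<Sum>j\<in>UNIV. f x * ?T i j x) \<partial>M) = (\<integral>x. f x * ball_op \<mu> p x \<partial>M)"
  proof (intro Bochner_Integration.integral_cong refl)
    fix x :: "real^'n"
    have T: "?T i j x = (if i = j then x $ i * pd i p x else 0) + (x $ j * x $ j) * pd i (pd i p) x
      - x $ i * pd i p x - x $ i * x $ j * pd j (pd i p) x" for i j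
      by (auto simp: pd_coord_mult[OF Pol_differentiable[OF P1]] algebra_simps)
    \<comment> \<open>The |x|^2 multiple of the Laplacian cancels against the radial part, and the
      Euler coefficients -(2 mu + 1), 1 and -d add up to the -(2 mu + d) of
      \<open>ball_op\<close>.\<close>
    have "(\<Sum>i\<in>UNIV. \<Sum>j\<in>UNIV. ?T i j x) = euler p x + (norm x)\<^sup>2 * (\<Sum>i\<in>UNIV. pd i (pd i p) x)
      - real CARD('n) * euler p x - (\<Sum>i\<in>UNIV. \<Sum>j\<in>UNIV. x $ i * x $ j * pd j (pd i p) x)"
      unfolding T sum.distrib sum_subtractf
      by (simp add: euler_def power2_norm_eq_inner inner_vec_def sum_product sum_distrib_left sum_distrib_right mult_ac)
        (subst sum.swap, simp)?
    moreover have "(\<Sum>i\<in>UNIV. ?R i x) = (1 - (norm x)\<^sup>2) * (\<Sum>i\<in>UNIV. pd i (pd i p) x) - (2 * \<mu> + 1) * euler p x"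
      by (simp add: euler_def sum_subtractf sum_distrib_left mult_ac)
    ultimately have "(\<Sum>i\<in>UNIV. ?R i x) + (\<Sum>i\<in>UNIV. \<Sum>j\<in>UNIV. ?T i j x) = ball_op \<mu> p x"
      by (simp add: ball_op_def algebra_simps)
    then show "(\<Sum>i\<in>UNIV. f x * ?R i x) + (\<Sum>i\<in>UNIV. \<Sum>j\<in>UNIV. f x * ?T i j x) = f x * ball_op \<mu> p x"
      by (simp only: sum_distrib_left[symmetric] distrib_left[symmetric])
  qed
  finally show ?thesis .
qed

end

section \<open>Projections onto polynomials\<close>

lemma lspan_square_integrable:
  assumes "\<And>s. s \<in> S \<Longrightarrow> square_integrable M s" "p \<in> lspan S"
  shows "square_integrable M p"
  using assms(2)
proof induction
  case zero
  then show ?case by (simp add: square_integrable_def)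
next
  case (step p s c)
  show ?case
    by (rule square_integrable_add[OF step.IH square_integrable_scale[OF assms(1)[OF step.hyps(2)]]])
qed

lemma lspan_orthogonal:
  assumes S: "\<And>s. s \<in> S \<Longrightarrow> square_integrable M s" and f: "square_integrable M f"
    and 0: "\<And>s. s \<in> S \<Longrightarrow> (\<integral>x. f x * s x \<partial>M) = 0" and "p \<in> lspan S"
  shows "(\<integral>x. f x * p x \<partial>M) = 0"
  using assms(4)
proof induction
  case (step p s c)
  have "(\<integral>x. f x * (p x + c * s x) \<partial>M) = (\<integral>x. f x * p x + c * (f x * s x) \<partial>M)"
    by (simp add: algebra_simps)
  also have "\<dots> = 0"
    using step square_integrable_mult[OF f S[OF step.hyps(2)]]
      square_integrable_mult[OF f lspan_square_integrable[OF S step.hyps(1)]] 0 by simp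
  finally show ?case .
qed simp

text \<open>A generator that is almost everywhere dependent on the others is skipped.\<close>

lemma ex_orthogonal_projection:
  assumes "finite S" "\<And>s. s \<in> S \<Longrightarrow> square_integrable M s" "square_integrable M f"
  shows "\<exists>p\<in>lspan S. \<forall>s\<in>S. (\<integral>x. (f x - p x) * s x \<partial>M) = 0"
  using assms
proof (induction arbitrary: f rule: finite_induct)
  case empty
  then show ?case by (auto intro: lspan.zero)
next
  case (insert v S)
  have S: "\<And>s. s \<in> S \<Longrightarrow> square_integrable M s" and v: "square_integrable M v"
    using insert.prems(1) by auto
  obtain p where p: "p \<in> lspan S" "\<And>s. s \<in> S \<Longrightarrow> (\<integral>x. (f x - p x) * s x \<partial>M) = 0"
    using insert.IH[OF S insert.prems(2)] by blast
  obtain q where q: "q \<in> lspan S" "\<And>s. s \<in> S \<Longrightarrow> (\<integral>x. (v x - q x) * s x \<partial>M) = 0"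
    using insert.IH[OF S v] by blast
  have sub: "r \<in> lspan (insert v S)" if "r \<in> lspan S" for r
    by (rule lspan_mono[OF that]) auto
  define f' where "f' = (\<lambda>x. f x - p x)"
  define v' where "v' = (\<lambda>x. v x - q x)"
  have f': "square_integrable M f'" and v': "square_integrable M v'" and sq: "square_integrable M q"
    unfolding f'_def v'_def using S p(1) q(1) v insert.prems(2) lspan_square_integrable
    by (metis square_integrable_diff)+
  have f'S: "(\<integral>x. f' x * s x \<partial>M) = 0" and v'S: "(\<integral>x. v' x * s x \<partial>M) = 0" if "s \<in> S" for s
    using p(2)[OF that] q(2)[OF that] by (simp_all add: f'_def v'_def)
  define c where "c = (\<integral>x. f' x * v' x \<partial>M) / (\<integral>x. v' x * v' x \<partial>M)"
  define h where "h = (\<lambda>x. f' x - c * v' x)"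
  have h: "square_integrable M h"
    unfolding h_def by (intro square_integrable_diff square_integrable_scale f' v')
  have hS: "(\<integral>x. h x * s x \<partial>M) = 0" if "s \<in> S" for s
  proof -
    have "(\<integral>x. h x * s x \<partial>M) = (\<integral>x. f' x * s x - c * (v' x * s x) \<partial>M)"
      by (simp add: h_def algebra_simps)
    also have "\<dots> = 0"
      using square_integrable_mult[OF f' S[OF that]] square_integrable_mult[OF v' S[OF that]] f'S v'S that by simp
    finally show ?thesis .
  qed
  have hv': "(\<integral>x. h x * v' x \<partial>M) = 0"
  proof -
    have "(\<integral>x. h x * v' x \<partial>M) = (\<integral>x. f' x * v' x - c * (v' x * v' x) \<partial>M)"
      by (simp add: h_def algebra_simps)
    also have "\<dots> = (\<integral>x. f' x * v' x \<partial>M) - c * (\<integral>x. v' x * v' x \<partial>M)"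
      using square_integrable_mult[OF f' v'] square_integrable_mult[OF v' v'] by simp
    also have "\<dots> = 0"
    \<comment> \<open>In the degenerate case c is 0 by the convention for division by zero, and
      Cauchy-Schwarz makes the pairing of f' with v' vanish.\<close>
    proof (cases "(\<integral>x. v' x * v' x \<partial>M) = 0")
      case True
      then have "(\<integral>x. f' x * v' x \<partial>M)\<^sup>2 \<le> 0"
        using integral_Cauchy_Schwarz[OF f' v'] by (simp add: power2_eq_square[of "v' _"])
      then show ?thesis using True by simp
    qed (simp add: c_def)
    finally show ?thesis .
  qed
  have "(\<integral>x. h x * v x \<partial>M) = (\<integral>x. h x * v' x + h x * q x \<partial>M)"
    by (simp add: v'_def algebra_simps)
  also have "\<dots> = 0"
    using square_integrable_mult[OF h v'] square_integrable_mult[OF h sq] hv' lspan_orthogonal[OF S h hS q(1)] by simp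
  finally have hv: "(\<integral>x. h x * v x \<partial>M) = 0" .
  have "(\<lambda>x. p x + c * (v x - q x)) \<in> lspan (insert v S)"
    by (intro lspan_add lspan_scale lspan_diff sub p(1) q(1) lspan_base) simp
  moreover have "(\<integral>x. (f x - (p x + c * (v x - q x))) * s x \<partial>M) = 0" if "s \<in> insert v S" for s
    using that hS hv unfolding h_def f'_def v'_def by (auto simp: diff_diff_eq)
  ultimately show ?case
    by (intro bexI[of _ "\<lambda>x. p x + c * (v x - q x)"] ballI)
qed

lemma integral_square_triangle:
  assumes "square_integrable M f" "square_integrable M g" "square_integrable M h"
  shows "(\<integral>x. (f x - h x)\<^sup>2 \<partial>M) \<le> 2 * (\<integral>x. (f x - g x)\<^sup>2 \<partial>M) + 2 * (\<integral>x. (g x - h x)\<^sup>2 \<partial>M)"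
proof -
  have i: "integrable M (\<lambda>x. (f x - h x)\<^sup>2)" "integrable M (\<lambda>x. (f x - g x)\<^sup>2)" "integrable M (\<lambda>x. (g x - h x)\<^sup>2)"
    using assms square_integrable_diff[of M] unfolding square_integrable_def by blast+
  have "(\<integral>x. (f x - h x)\<^sup>2 \<partial>M) \<le> (\<integral>x. 2 * (f x - g x)\<^sup>2 + 2 * (g x - h x)\<^sup>2 \<partial>M)"
  proof (rule integral_mono)
    fix x
    have "0 \<le> ((f x - g x) - (g x - h x))\<^sup>2" by simp
    then show "(f x - h x)\<^sup>2 \<le> 2 * (f x - g x)\<^sup>2 + 2 * (g x - h x)\<^sup>2"
      by (simp add: power2_eq_square algebra_simps)
  qed (use i in auto)
  also have "\<dots> = 2 * (\<integral>x. (f x - g x)\<^sup>2 \<partial>M) + 2 * (\<integral>x. (g x - h x)\<^sup>2 \<partial>M)"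
    using i by simp
  finally show ?thesis .
qed

section \<open>Density of the polynomials in the weighted L2 space and convergence of the
  projections\<close>

context weighted_ball
begin

lemma mass_pos: "(\<integral>x. (1::real) \<partial>M) > 0"
  using mass Bochner_Integration.integral_nonneg[of M "\<lambda>x. 1::real"] by linarith

lemma AE_M: "negligible Z \<Longrightarrow> AE x in M. x \<notin> Z"
proof -
  assume "negligible Z"
  then have "AE x in lebesgue. x \<notin> Z"
    by (intro AE_not_in) (simp add: negligible_iff_null_sets)
  then have "AE x in lebesgue_ball. x \<notin> Z"
    by (subst AE_restrict_space_iff) (auto elim: eventually_mono)
  moreover have "(\<lambda>x. ennreal (W \<mu> x)) \<in> borel_measurable lebesgue_ball"
    using measurable_lebesgue_onI[OF W_measurable] by measurable
  ultimately show ?thesis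
    unfolding M_def ballM_def by (subst AE_density) (auto elim: eventually_mono)
qed

text \<open>Measurability yields continuous functions converging to f off a null set. Clamping them
  to [-B, B] keeps them continuous and dominated, and Stone-Weierstrass on the closed ball turns one
  of them into a polynomial.\<close>

lemma bounded_approx_Pol:
  assumes f: "f \<in> borel_measurable lebesgue_ball" and B: "\<And>x. \<bar>f x\<bar> \<le> B" and e: "e > 0"
  shows "\<exists>n. \<exists>p\<in>Pol n. (\<integral>x. (f x - p x)\<^sup>2 \<partial>M) < e"
proof -
  have "f measurable_on ball 0 1"
    using f by (subst measurable_on_iff_borel_measurable) auto
  then obtain Z g where Z: "negligible Z" and g: "\<And>n. continuous_on UNIV (g n)"
    and lim: "\<And>x. x \<notin> Z \<Longrightarrow> (\<lambda>n. g n x) \<longlonglongrightarrow> (if x \<in> ball 0 1 then f x else 0)"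
    unfolding measurable_on_def by blast
  define h where "h = (\<lambda>n x. max (- B) (min B (g n x)))"
  have B0: "B \<ge> 0" using B[of 0] by linarith
  have hc: "continuous_on UNIV (h n)" for n
    unfolding h_def by (intro continuous_intros g)
  have hm: "h n \<in> borel_measurable lebesgue_ball" for n
    by (rule continuous_measurable_ball[OF hc])
  have hB: "\<bar>h n x\<bar> \<le> B" for n x using B0 by (auto simp: h_def)
  have sf: "sq f" and sh: "\<And>n. sq (h n)"
    using sq_bounded[OF f B] sq_bounded[OF hm hB] by auto
  have "(\<lambda>n. \<integral>x. (f x - h n x)\<^sup>2 \<partial>M) \<longlonglongrightarrow> (\<integral>x. 0 \<partial>M)"
  proof (rule integral_dominated_convergence)
    show "(\<lambda>x. (f x - h n x)\<^sup>2) \<in> borel_measurable M" for n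
      using f hm[of n] unfolding M_def measurable_ballM by measurable
    show "integrable M (\<lambda>x. (2 * B)\<^sup>2 * 1)"
      by (rule integrable_mult_right[OF integrable_one])
    show "AE x in M. (\<lambda>n. (f x - h n x)\<^sup>2) \<longlonglongrightarrow> 0"
      using AE_M[OF Z] AE_space[of M]
    proof eventually_elim
      case (elim x)
      then have "(\<lambda>n. g n x) \<longlonglongrightarrow> f x" using lim[of x] by (simp add: M_def)
      then have "(\<lambda>n. (f x - h n x)\<^sup>2) \<longlonglongrightarrow> (f x - max (- B) (min B (f x)))\<^sup>2"
        unfolding h_def by (intro tendsto_intros)
      moreover have "max (- B) (min B (f x)) = f x"
        using B[of x] by (auto simp: max_def min_def abs_le_iff)
      ultimately show ?case by simp
    qed
    show "AE x in M. norm ((f x - h n x)\<^sup>2) \<le> (2 * B)\<^sup>2 * 1" for n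
    proof (rule AE_I2)
      fix x
      have "\<bar>f x - h n x\<bar> \<le> 2 * B" using B[of x] hB[of n x] by linarith
      then have "\<bar>f x - h n x\<bar>\<^sup>2 \<le> (2 * B)\<^sup>2" by (intro power_mono) auto
      then show "norm ((f x - h n x)\<^sup>2) \<le> (2 * B)\<^sup>2 * 1" by simp
    qed
  qed simp
  \<comment> \<open>A quarter, because \<open>integral_square_triangle\<close> doubles each of the
    two errors.\<close>
  then have "eventually (\<lambda>n. (\<integral>x. (f x - h n x)\<^sup>2 \<partial>M) < e / 4) sequentially"
    using e by (intro order_tendstoD) auto
  then obtain n where n: "(\<integral>x. (f x - h n x)\<^sup>2 \<partial>M) < e / 4"
    by (meson eventually_happens trivial_limit_sequentially)
  define m where "m = (\<integral>x. (1::real) \<partial>M)"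
  \<comment> \<open>A uniform error of this size costs exactly e/4 after squaring and integrating
    over the total mass m.\<close>
  define \<delta> where "\<delta> = sqrt (e / (4 * m))"
  have m: "m > 0" using mass_pos by (simp add: m_def)
  have d: "\<delta> > 0" "\<delta>\<^sup>2 * m = e / 4" using m e by (auto simp: \<delta>_def)
  obtain p where p: "real_polynomial_function p" "\<And>x. x \<in> cball 0 1 \<Longrightarrow> \<bar>h n x - p x\<bar> < \<delta>"
    using Stone_Weierstrass_real_polynomial_function[of "cball 0 1" "h n" \<delta>] d continuous_on_subset[OF hc] by auto
  obtain k where k: "p \<in> Pol k" using real_polynomial_function_Pol[OF p(1)] by blast
  have sp: "sq p" by (rule sq_Pol[OF k])
  have "(\<integral>x. (h n x - p x)\<^sup>2 \<partial>M) \<le> (\<integral>x. \<delta>\<^sup>2 * 1 \<partial>M)"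
  proof (rule integral_mono)
    show "integrable M (\<lambda>x. (h n x - p x)\<^sup>2)"
      using square_integrable_diff[OF sh sp] by (simp add: square_integrable_def)
    show "integrable M (\<lambda>x. \<delta>\<^sup>2 * 1)" by (rule integrable_mult_right[OF integrable_one])
    fix x assume "x \<in> space M"
    then have "\<bar>h n x - p x\<bar> \<le> \<delta>" using p(2)[of x] by (simp add: M_def)
    then have "\<bar>h n x - p x\<bar>\<^sup>2 \<le> \<delta>\<^sup>2" by (intro power_mono) auto
    then show "(h n x - p x)\<^sup>2 \<le> \<delta>\<^sup>2 * 1" by simp
  qed
  also have "\<dots> = e / 4"
    unfolding integral_mult_right_zero using d(2) by (simp only: m_def)
  finally have "(\<integral>x. (f x - p x)\<^sup>2 \<partial>M) < e"
    using integral_square_triangle[OF sf sh[of n] sp] n by linarith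
  then show ?thesis using k by blast
qed

text \<open>Truncating f at height k reduces to the bounded case; the truncation error is dominated
  by |f| and is eventually 0 at each point.\<close>

lemma approx_Pol:
  assumes f: "sq f" and e: "e > 0"
  shows "\<exists>n. \<exists>p\<in>Pol n. (\<integral>x. (f x - p x)\<^sup>2 \<partial>M) < e"
proof -
  define h where "h = (\<lambda>k x. max (- real k) (min (real k) (f x)))"
  have hm: "h k \<in> borel_measurable lebesgue_ball" for k
    using sq_measurable[OF f] unfolding h_def by measurable
  have hB: "\<bar>h k x\<bar> \<le> real k" for k x by (auto simp: h_def)
  have "(\<lambda>k. \<integral>x. (f x - h k x)\<^sup>2 \<partial>M) \<longlonglongrightarrow> (\<integral>x. 0 \<partial>M)"
  proof (rule integral_dominated_convergence)
    show "(\<lambda>x. (f x - h n x)\<^sup>2) \<in> borel_measurable M" for n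
      using sq_measurable[OF f] hm[of n] unfolding M_def measurable_ballM by measurable
    show "integrable M (\<lambda>x. (f x)\<^sup>2)"
      using f by (simp add: square_integrable_def)
    show "AE x in M. (\<lambda>k. (f x - h k x)\<^sup>2) \<longlonglongrightarrow> 0"
    proof (rule AE_I2)
      fix x
      obtain K :: nat where K: "\<bar>f x\<bar> \<le> real K" using real_arch_simple by blast
      have "eventually (\<lambda>k. (f x - h k x)\<^sup>2 = 0) sequentially"
        using eventually_ge_at_top[of K]
      proof eventually_elim
        case (elim k)
        then have "\<bar>f x\<bar> \<le> real k" using K by linarith
        then show ?case by (auto simp: h_def max_def min_def abs_le_iff)
      qed
      then show "(\<lambda>k. (f x - h k x)\<^sup>2) \<longlonglongrightarrow> 0" by (rule tendsto_eventually)
    qed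
    show "AE x in M. norm ((f x - h n x)\<^sup>2) \<le> (f x)\<^sup>2" for n
    proof (rule AE_I2)
      fix x
      have "\<bar>f x - h n x\<bar> \<le> \<bar>f x\<bar>" by (auto simp: h_def max_def min_def)
      then have "\<bar>f x - h n x\<bar>\<^sup>2 \<le> \<bar>f x\<bar>\<^sup>2" by (intro power_mono) auto
      then show "norm ((f x - h n x)\<^sup>2) \<le> (f x)\<^sup>2" by simp
    qed
  qed simp
  then have "eventually (\<lambda>k. (\<integral>x. (f x - h k x)\<^sup>2 \<partial>M) < e / 4) sequentially"
    using e by (intro order_tendstoD) auto
  then obtain k where k: "(\<integral>x. (f x - h k x)\<^sup>2 \<partial>M) < e / 4"
    by (meson eventually_happens trivial_limit_sequentially)
  obtain n p where p: "p \<in> Pol n" "(\<integral>x. (h k x - p x)\<^sup>2 \<partial>M) < e / 4"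
    using bounded_approx_Pol[OF hm hB, of "e / 4" k] e by auto
  then have "(\<integral>x. (f x - p x)\<^sup>2 \<partial>M) < e"
    using integral_square_triangle[OF f sq_bounded[OF hm hB] sq_Pol[OF p(1)], of k] k by linarith
  then show ?thesis using p(1) by blast
qed

lemma ex_projection:
  assumes "sq f"
  shows "\<exists>p\<in>Pol n. \<forall>s\<in>Pol n. (\<integral>x. (f x - p x) * s x \<partial>M) = 0"
proof -
  have S: "sq s" if "s \<in> monoms n" for s
    using sq_Pol lspan_base[OF that] by blast
  obtain p where p: "p \<in> Pol n" "\<And>s. s \<in> monoms n \<Longrightarrow> (\<integral>x. (f x - p x) * s x \<partial>M) = 0"
    using ex_orthogonal_projection[OF finite_monoms S assms] by blast
  have "sq (\<lambda>x. f x - p x)"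
    by (intro square_integrable_diff assms sq_Pol[OF p(1)])
  from lspan_orthogonal[OF S this p(2)] p(1) show ?thesis by blast
qed

lemma projection_best:
  assumes f: "sq f" and p: "p \<in> Pol n" and orth: "\<And>s. s \<in> Pol n \<Longrightarrow> (\<integral>x. (f x - p x) * s x \<partial>M) = 0"
    and q: "q \<in> Pol n"
  shows "(\<integral>x. (f x - p x)\<^sup>2 \<partial>M) \<le> (\<integral>x. (f x - q x)\<^sup>2 \<partial>M)"
proof -
  have d: "sq (\<lambda>x. f x - p x)" "sq (\<lambda>x. p x - q x)"
    by (intro square_integrable_diff f sq_Pol[OF p] sq_Pol[OF q])+
  have i: "integrable M (\<lambda>x. (f x - p x)\<^sup>2)" "integrable M (\<lambda>x. (p x - q x)\<^sup>2)"
    "integrable M (\<lambda>x. (f x - p x) * (p x - q x))"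
    using d square_integrable_mult[OF d] by (auto simp: square_integrable_def)
  have "(\<integral>x. (f x - q x)\<^sup>2 \<partial>M) = (\<integral>x. (f x - p x)\<^sup>2 + 2 * ((f x - p x) * (p x - q x)) + (p x - q x)\<^sup>2 \<partial>M)"
    by (intro Bochner_Integration.integral_cong) (auto simp: power2_eq_square algebra_simps)
  also have "\<dots> = (\<integral>x. (f x - p x)\<^sup>2 \<partial>M) + 2 * (\<integral>x. (f x - p x) * (p x - q x) \<partial>M) + (\<integral>x. (p x - q x)\<^sup>2 \<partial>M)"
    using i by simp
  also have "(\<integral>x. (f x - p x) * (p x - q x) \<partial>M) = 0"
    by (rule orth[OF lspan_diff[OF p q]])
  finally show ?thesis by simp
qed

lemma projections_converge:
  assumes f: "sq f" and p: "\<And>n. p n \<in> Pol n"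
    and orth: "\<And>n s. s \<in> Pol n \<Longrightarrow> (\<integral>x. (f x - p n x) * s x \<partial>M) = 0"
  shows "(\<lambda>n. \<integral>x. (f x - p n x)\<^sup>2 \<partial>M) \<longlonglongrightarrow> 0"
proof (rule LIMSEQ_I)
  fix e :: real assume "e > 0"
  then obtain k q where q: "q \<in> Pol k" "(\<integral>x. (f x - q x)\<^sup>2 \<partial>M) < e"
    using approx_Pol[OF f] by blast
  have "norm ((\<integral>x. (f x - p n x)\<^sup>2 \<partial>M) - 0) < e" if "n \<ge> k" for n
    using projection_best[OF f p orth Pol_mono[OF q(1) that]] q(2) by simp
  then show "\<exists>no. \<forall>n\<ge>no. norm ((\<integral>x. (f x - p n x)\<^sup>2 \<partial>M) - 0) < e" by blast
qed

section \<open>Spectral gap and uncertainty\<close>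

lemma lam_nonneg: "lam CARD('n) \<mu> \<ge> 0"
proof -
  have "CARD('n) \<ge> 1" by (simp add: Suc_leI)
  then show ?thesis using mu by (simp add: lam_def)
qed

definition form :: "(real^'n \<Rightarrow> real^'n) \<Rightarrow> (real^'n \<Rightarrow> real^'n) \<Rightarrow> real" where
  "form g h = (\<integral>x. gam x (g x) (h x) \<partial>M)"

lemma form_nonneg: "form g g \<ge> 0"
  unfolding form_def
  by (rule integral_nonneg_AE, rule AE_I2) (simp add: gam_nonneg M_def)

text \<open>Stated for arbitrary square-integrable fields, since the uncertainty inequality pairs a
  gradient with the field p e, which need not be a gradient.\<close>

lemma form_add:
  assumes "\<And>i. sq (\<lambda>x. g x $ i)" "\<And>i. sq (\<lambda>x. h x $ i)"
  shows "form (\<lambda>x. g x + c *\<^sub>R h x) (\<lambda>x. g x + c *\<^sub>R h x) = form g g + 2 * c * form g h + c\<^sup>2 * form h h"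
proof -
  have "form (\<lambda>x. g x + c *\<^sub>R h x) (\<lambda>x. g x + c *\<^sub>R h x) =
    (\<integral>x. gam x (g x) (g x) + 2 * c * gam x (g x) (h x) + c\<^sup>2 * gam x (h x) (h x) \<partial>M)"
    unfolding form_def
  proof (intro Bochner_Integration.integral_cong refl)
    fix x
    show "gam x (g x + c *\<^sub>R h x) (g x + c *\<^sub>R h x) = gam x (g x) (g x) + 2 * c * gam x (g x) (h x) + c\<^sup>2 * gam x (h x) (h x)"
      unfolding gam_lin gam_commute[of x _ "g x + c *\<^sub>R h x"] gam_commute[of x "h x" "g x"]
      by (simp add: power2_eq_square algebra_simps)
  qed
  then show ?thesis
    unfolding form_def by (simp add: gam_integrable assms)
qed

lemma sq_pgrad: "p \<in> Pol n \<Longrightarrow> sq (\<lambda>x. pgrad p x $ i)"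
  using weakly_Pol by (simp add: weakly_def)

text \<open>\<open>ball_op\<close> maps \<open>Pol n\<close> into itself, so f - p is orthogonal to
  \<open>ball_op \<mu> p\<close> as well, and Green's identity makes the form of g -
  \<open>pgrad p\<close> with \<open>pgrad p\<close> vanish. Nonnegativity of the form at that
  difference finishes the proof.\<close>

lemma form_projection_le:
  assumes f: "weakly f g" and p: "p \<in> Pol n" and orth: "\<And>s. s \<in> Pol n \<Longrightarrow> (\<integral>x. (f x - p x) * s x \<partial>M) = 0"
  shows "form (pgrad p) (pgrad p) \<le> form g g"
proof -
  have sf: "sq f" and sg: "\<And>i. sq (\<lambda>x. g x $ i)" using f by (auto simp: weakly_def)
  have i: "integrable M (\<lambda>x. f x * ball_op \<mu> p x)" "integrable M (\<lambda>x. p x * ball_op \<mu> p x)"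
    by (intro square_integrable_mult sf sq_Pol[OF p] sq_Pol[OF Pol_ball_op[OF p]])+
  have "(\<integral>x. f x * ball_op \<mu> p x \<partial>M) - (\<integral>x. p x * ball_op \<mu> p x \<partial>M) = (\<integral>x. (f x - p x) * ball_op \<mu> p x \<partial>M)"
    using i by (simp add: left_diff_distrib)
  also have "\<dots> = 0" by (rule orth[OF Pol_ball_op[OF p]])
  finally have "form g (pgrad p) = form (pgrad p) (pgrad p)"
    using green[OF f p] green[OF weakly_Pol[OF p] p] by (simp add: form_def)
  moreover have "0 \<le> form g g + 2 * (-1) * form g (pgrad p) + (-1)\<^sup>2 * form (pgrad p) (pgrad p)"
    using form_nonneg[of "\<lambda>x. g x + (-1) *\<^sub>R pgrad p x"] unfolding form_add[OF sg sq_pgrad[OF p]] .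
  ultimately show ?thesis by simp
qed

text \<open>A polynomial orthogonal to all polynomials of smaller degree is an eigenfunction of \<open>ball_op\<close> in
  the weak sense, because \<open>ball_op\<close> acts on leading terms by a scalar.\<close>

lemma form_orthogonal_Pol:
  assumes r: "r \<in> Pol (Suc n)" and orth: "\<And>s. s \<in> Pol n \<Longrightarrow> (\<integral>x. r x * s x \<partial>M) = 0"
  shows "form (pgrad r) (pgrad r) = real n * (real n + 2 * lam CARD('n) \<mu>) * (\<integral>x. (r x)\<^sup>2 \<partial>M)"
proof -
  let ?c = "real n * (real n + 2 * lam CARD('n) \<mu>)"
  have "0 = (\<integral>x. r x * (ball_op \<mu> r x + ?c * r x) \<partial>M)"
    by (rule orth[OF Pol_ball_op_Suc[OF r], symmetric])
  also have "\<dots> = (\<integral>x. r x * ball_op \<mu> r x + ?c * (r x)\<^sup>2 \<partial>M)"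
    by (simp add: power2_eq_square algebra_simps)
  also have "\<dots> = (\<integral>x. r x * ball_op \<mu> r x \<partial>M) + ?c * (\<integral>x. (r x)\<^sup>2 \<partial>M)"
    using sq_Pol[OF r] square_integrable_mult[OF sq_Pol[OF r] sq_Pol[OF Pol_ball_op[OF r]]]
    by (simp add: square_integrable_def)
  finally show ?thesis
    using green[OF weakly_Pol[OF r] r] by (simp add: form_def)
qed

text \<open>The component r of top degree, orthogonal to \<open>Pol n\<close>, is split off. Since
  \<open>ball_op\<close> preserves \<open>Pol n\<close>, p = q + r is orthogonal for the form as
  well as in L2, and on r the form is n(n + 2 lambda) times the squared norm, with factor at least 2
  lambda + 1 once n >= 1.\<close>

lemma poincare_Pol:
  assumes "p \<in> Pol n" "(\<integral>x. p x \<partial>M) = 0"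
  shows "(2 * lam CARD('n) \<mu> + 1) * (\<integral>x. (p x)\<^sup>2 \<partial>M) \<le> form (pgrad p) (pgrad p)"
  using assms
proof (induction n arbitrary: p)
  case 0
  have "p = (\<lambda>x. 0)" using 0(1) by (cases rule: lspan.cases) auto
  then show ?case using form_nonneg by simp
next
  case (Suc n)
  note p = Suc.prems(1)
  obtain q where q: "q \<in> Pol n" and orth: "\<And>s. s \<in> Pol n \<Longrightarrow> (\<integral>x. (p x - q x) * s x \<partial>M) = 0"
    using ex_projection[OF sq_Pol[OF p], of n] by blast
  define r where "r = (\<lambda>x. p x - q x)"
  have r: "r \<in> Pol (Suc n)" unfolding r_def by (intro lspan_diff p Pol_Suc[OF q])
  have orth': "(\<integral>x. r x * s x \<partial>M) = 0" if "s \<in> Pol n" for s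
    using orth[OF that] by (simp add: r_def)
  have pr: "p = (\<lambda>x. q x + 1 * r x)" by (simp add: r_def)
  have ip: "integrable M p" "integrable M q" "integrable M r"
    using sq_integrable sq_Pol p q r by blast+
  have "(\<integral>x. q x \<partial>M) = 0 \<and> real n * (real n + 2 * lam CARD('n) \<mu>) * (\<integral>x. (r x)\<^sup>2 \<partial>M) \<ge> (2 * lam CARD('n) \<mu> + 1) * (\<integral>x. (r x)\<^sup>2 \<partial>M)"
  proof (cases n)
    \<comment> \<open>Here the eigenvalue is 0, so the gap rests on the mean: \<open>Pol 0\<close>
      contains only the zero function, p is constant, and mean zero with nonzero mass forces p =
      0.\<close>
    case 0
    have q0: "q = (\<lambda>x. 0)" using q unfolding 0 by (cases rule: lspan.cases) auto
    obtain c where c: "p = (\<lambda>x. c)"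
    proof -
      have "\<exists>c. p = (\<lambda>x. c)"
        using p unfolding 0 by induction (auto simp: monoms.simps fun_eq_iff)
      then show ?thesis using that by blast
    qed
    have "(\<integral>x. c * 1 \<partial>M) = 0" using Suc.prems(2) unfolding c by simp
    then have "c = 0" unfolding integral_mult_right_zero using mass by (simp only: mult_eq_0_iff simp_thms)
    then show ?thesis by (simp add: r_def q0 c)
  next
    case (Suc k)
    have "(\<integral>x. r x * 1 \<partial>M) = 0"
      by (rule orth') (use Pol_const[of 1 k] Suc in simp)
    then have "(\<integral>x. q x \<partial>M) = 0"
      using Suc.prems(2) ip by (simp add: r_def)
    moreover have "2 * lam CARD('n) \<mu> + 1 \<le> real n * (real n + 2 * lam CARD('n) \<mu>)"
    proof -
      have "1 * (1 + 2 * lam CARD('n) \<mu>) \<le> real n * (real n + 2 * lam CARD('n) \<mu>)"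
        using Suc lam_nonneg by (intro mult_mono) auto
      then show ?thesis by simp
    qed
    ultimately show ?thesis by (intro conjI mult_right_mono) auto
  qed
  then have q0: "(\<integral>x. q x \<partial>M) = 0" and rr: "(2 * lam CARD('n) \<mu> + 1) * (\<integral>x. (r x)\<^sup>2 \<partial>M) \<le> form (pgrad r) (pgrad r)"
    using form_orthogonal_Pol[OF r orth'] by auto
  have "(\<integral>x. r x * ball_op \<mu> q x \<partial>M) = 0" by (rule orth'[OF Pol_ball_op[OF q]])
  then have "form (pgrad r) (pgrad q) = 0"
    using green[OF weakly_Pol[OF r] q] by (simp add: form_def)
  then have z: "form (pgrad q) (pgrad r) = 0" unfolding form_def by (simp only: gam_commute)
  have "pgrad p = (\<lambda>x. pgrad q x + 1 *\<^sub>R pgrad r x)"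
    unfolding pr pgrad_def using pd_lin[OF Pol_differentiable[OF q] Pol_differentiable[OF r], of _ 1]
    by (auto simp: vec_eq_iff)
  then have "form (pgrad p) (pgrad p) = form (pgrad q) (pgrad q) + form (pgrad r) (pgrad r)"
    using form_add[OF sq_pgrad[OF q] sq_pgrad[OF r], of 1] z by simp
  moreover have "(\<integral>x. (p x)\<^sup>2 \<partial>M) = (\<integral>x. (q x)\<^sup>2 \<partial>M) + (\<integral>x. (r x)\<^sup>2 \<partial>M)"
  proof -
    have "(\<integral>x. (p x)\<^sup>2 \<partial>M) = (\<integral>x. (q x)\<^sup>2 + 2 * (r x * q x) + (r x)\<^sup>2 \<partial>M)"
      unfolding pr by (simp add: power2_eq_square algebra_simps)
    also have "\<dots> = (\<integral>x. (q x)\<^sup>2 \<partial>M) + 2 * (\<integral>x. r x * q x \<partial>M) + (\<integral>x. (r x)\<^sup>2 \<partial>M)"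
      using sq_Pol[OF q] sq_Pol[OF r] square_integrable_mult[OF sq_Pol[OF r] sq_Pol[OF q]]
      by (simp add: square_integrable_def)
    finally show ?thesis using orth'[OF q] by simp
  qed
  ultimately show ?case
    using Suc.IH[OF q q0] rr by (simp add: distrib_left)
qed

lemma Pol_inner: "(\<lambda>x. x \<bullet> e) \<in> Pol (Suc (Suc 0))"
  unfolding inner_vec_def inner_real_def mult.commute[of "_ $ _" "e $ _"]
  by (intro lspan_sum lspan_scale Pol_coord finite)

lemma pd_inner: "pd i (\<lambda>x. x \<bullet> e) x = e $ i"
  by (subst pd_eqI[OF bounded_linear_imp_has_derivative[OF bounded_linear_inner_left]])
    (simp add: inner_axis inner_commute)

lemma ball_op_inner: "ball_op \<mu> (\<lambda>x. x \<bullet> e) (x::real^'n) = - (2 * lam CARD('n) \<mu> + 1) * (x \<bullet> e)"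
proof -
  have 1: "pd i (\<lambda>x. x \<bullet> e) = (\<lambda>x. e $ i)" for i
    by (rule ext) (rule pd_inner)
  have "euler (\<lambda>x. x \<bullet> e) x = x \<bullet> e"
    unfolding euler_def pd_inner by (simp add: inner_vec_def)
  then show ?thesis
    by (simp add: ball_op_def 1 lam_def field_simps)
qed

text \<open>Cauchy-Schwarz for the form is applied to \<open>pgrad p\<close> and the field p e,
  where e is the gradient of t = <x, e>. Twice their pairing is the form of the gradients of p^2 and
  t, so Green's identity with p^2 in the place of f moves the operator onto t. The density of p e
  with itself is (1 - t^2) p^2 because |e| = 1.\<close>

lemma uncertainty_Pol:
  assumes p: "p \<in> Pol n" and e: "norm e = 1"
  shows "((lam CARD('n) \<mu> + 1/2) * (\<integral>x. (x \<bullet> e) * (p x)\<^sup>2 \<partial>M))\<^sup>2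
    \<le> (\<integral>x. (1 - (x \<bullet> e)\<^sup>2) * (p x)\<^sup>2 \<partial>M) * form (pgrad p) (pgrad p)"
proof -
  have p2: "(\<lambda>x. p x * p x) \<in> Pol (n + n)" by (rule Pol_mult[OF p p])
  have ge: "pgrad (\<lambda>x. x \<bullet> e) = (\<lambda>x. e)"
    by (auto simp: pgrad_def pd_inner vec_eq_iff)
  \<comment> \<open>The leading 0 gives the gradient of p^2 the shape that \<open>gam_lin\<close>
    rewrites.\<close>
  have gp2: "pgrad (\<lambda>x. p x * p x) x = 0 + (2 * p x) *\<^sub>R pgrad p x" for x
    by (simp add: pgrad_def vec_eq_iff pd_mult Pol_differentiable[OF p])
  have spe: "sq (\<lambda>x. (p x *\<^sub>R e) $ i)" for i
    using square_integrable_scale[OF sq_Pol[OF p], of "e $ i"] by (simp add: mult.commute)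
  have "form (pgrad p) (\<lambda>x. p x *\<^sub>R e) = (lam CARD('n) \<mu> + 1/2) * (\<integral>x. (x \<bullet> e) * (p x)\<^sup>2 \<partial>M)"
  proof -
    have "2 * form (pgrad p) (\<lambda>x. p x *\<^sub>R e) = (\<integral>x. gam x (pgrad (\<lambda>x. p x * p x) x) (pgrad (\<lambda>x. x \<bullet> e) x) \<partial>M)"
      unfolding ge gp2 gam_lin form_def integral_mult_right_zero[symmetric]
      by (simp add: gam_def algebra_simps)
    also have "\<dots> = - (\<integral>x. (p x * p x) * ball_op \<mu> (\<lambda>x. x \<bullet> e) x \<partial>M)"
      by (rule green[OF weakly_Pol[OF p2] Pol_inner])
    also have "\<dots> = (\<integral>x. (2 * lam CARD('n) \<mu> + 1) * ((x \<bullet> e) * (p x)\<^sup>2) \<partial>M)"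
      unfolding ball_op_inner integral_minus[symmetric]
      by (intro Bochner_Integration.integral_cong) (auto simp: power2_eq_square algebra_simps)
    also have "\<dots> = (2 * lam CARD('n) \<mu> + 1) * (\<integral>x. (x \<bullet> e) * (p x)\<^sup>2 \<partial>M)"
      by (rule integral_mult_right_zero)
    finally show ?thesis unfolding distrib_right by linarith
  qed
  moreover have "form (\<lambda>x. p x *\<^sub>R e) (\<lambda>x. p x *\<^sub>R e) = (\<integral>x. (1 - (x \<bullet> e)\<^sup>2) * (p x)\<^sup>2 \<partial>M)"
    unfolding form_def
  proof (intro Bochner_Integration.integral_cong refl)
    fix x
    have "e \<bullet> e = 1" using e by (simp add: dot_square_norm)
    then show "gam x (p x *\<^sub>R e) (p x *\<^sub>R e) = (1 - (x \<bullet> e)\<^sup>2) * (p x)\<^sup>2"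
      by (simp add: gam_def power2_eq_square algebra_simps)
  qed
  moreover have "(form (pgrad p) (\<lambda>x. p x *\<^sub>R e))\<^sup>2 \<le> form (\<lambda>x. p x *\<^sub>R e) (\<lambda>x. p x *\<^sub>R e) * form (pgrad p) (pgrad p)"
  proof (rule quadratic_discriminant)
    fix c
    show "0 \<le> form (\<lambda>x. p x *\<^sub>R e) (\<lambda>x. p x *\<^sub>R e) * c\<^sup>2 + 2 * form (pgrad p) (\<lambda>x. p x *\<^sub>R e) * c + form (pgrad p) (pgrad p)"
      using form_nonneg[of "\<lambda>x. pgrad p x + c *\<^sub>R (p x *\<^sub>R e)"]
      unfolding form_add[OF sq_pgrad[OF p] spe] by (simp add: algebra_simps)
  qed
  ultimately show ?thesis by simp
qed

text \<open>Expand w p^2 = w f^2 - 2 w f (f - p) + w (f - p)^2. The last term is bounded by the L2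
  error and the middle one, through Cauchy-Schwarz, by its square root.\<close>

lemma integral_weighted_square_tendsto:
  assumes f: "sq f" and p: "\<And>n. sq (p n)" and lim: "(\<lambda>n. \<integral>x. (f x - p n x)\<^sup>2 \<partial>M) \<longlonglongrightarrow> 0"
    and w: "w \<in> borel_measurable lebesgue_ball" "\<And>x. x \<in> ball 0 1 \<Longrightarrow> \<bar>w x\<bar> \<le> 1"
  shows "(\<lambda>n. \<integral>x. w x * (p n x)\<^sup>2 \<partial>M) \<longlonglongrightarrow> (\<integral>x. w x * (f x)\<^sup>2 \<partial>M)"
proof -
  have swm: "sq (\<lambda>x. w x * u x)" if "sq u" for u
    by (rule square_integrable_bounded_mult[OF that, of _ 1]) (use w in \<open>auto simp: M_def\<close>)
  have sd: "sq (\<lambda>x. f x - p n x)" for n by (rule square_integrable_diff[OF f p])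
  have i1: "integrable M (\<lambda>x. (w x * (f x - p n x)) * (f x - p n x))" for n
    by (rule square_integrable_mult[OF swm[OF sd] sd])
  have i2: "integrable M (\<lambda>x. (w x * f x) * (f x - p n x))" for n
    by (rule square_integrable_mult[OF swm[OF f] sd])
  have i3: "integrable M (\<lambda>x. (w x * f x) * f x)"
    by (rule square_integrable_mult[OF swm[OF f] f])
  have "(\<lambda>n. \<integral>x. (w x * (f x - p n x)) * (f x - p n x) \<partial>M) \<longlonglongrightarrow> 0"
  proof (rule Lim_null_comparison[OF _ lim], rule always_eventually, rule allI)
    fix n
    have "norm (\<integral>x. (w x * (f x - p n x)) * (f x - p n x) \<partial>M) \<le> (\<integral>x. norm ((w x * (f x - p n x)) * (f x - p n x)) \<partial>M)"
      by (rule integral_norm_bound)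
    also have "\<dots> \<le> (\<integral>x. (f x - p n x)\<^sup>2 \<partial>M)"
    proof (rule integral_mono)
      show "integrable M (\<lambda>x. norm ((w x * (f x - p n x)) * (f x - p n x)))" using i1 by simp
      show "integrable M (\<lambda>x. (f x - p n x)\<^sup>2)" using sd by (simp add: square_integrable_def)
      fix x assume "x \<in> space M"
      then have "\<bar>w x\<bar> * (f x - p n x)\<^sup>2 \<le> 1 * (f x - p n x)\<^sup>2"
        using w(2)[of x] by (intro mult_right_mono) (auto simp: M_def)
      then show "norm ((w x * (f x - p n x)) * (f x - p n x)) \<le> (f x - p n x)\<^sup>2"
        by (simp add: abs_mult power2_eq_square mult.assoc)
    qed
    finally show "norm (\<integral>x. (w x * (f x - p n x)) * (f x - p n x) \<partial>M) \<le> (\<integral>x. (f x - p n x)\<^sup>2 \<partial>M)" .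
  qed
  moreover have "(\<lambda>n. \<integral>x. (w x * f x) * (f x - p n x) \<partial>M) \<longlonglongrightarrow> 0"
  proof (rule Lim_null_comparison, rule always_eventually, rule allI)
    fix n
    show "norm (\<integral>x. (w x * f x) * (f x - p n x) \<partial>M) \<le> sqrt ((\<integral>x. (w x * f x)\<^sup>2 \<partial>M) * (\<integral>x. (f x - p n x)\<^sup>2 \<partial>M))"
      using real_sqrt_le_mono[OF integral_Cauchy_Schwarz[OF swm[OF f] sd[of n]]] by simp
  next
    have "(\<lambda>n. sqrt ((\<integral>x. (w x * f x)\<^sup>2 \<partial>M) * (\<integral>x. (f x - p n x)\<^sup>2 \<partial>M))) \<longlonglongrightarrow> sqrt ((\<integral>x. (w x * f x)\<^sup>2 \<partial>M) * 0)"
      by (intro tendsto_real_sqrt tendsto_mult tendsto_const lim)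
    then show "(\<lambda>n. sqrt ((\<integral>x. (w x * f x)\<^sup>2 \<partial>M) * (\<integral>x. (f x - p n x)\<^sup>2 \<partial>M))) \<longlonglongrightarrow> 0" by simp
  qed
  ultimately have "(\<lambda>n. (\<integral>x. (w x * f x) * f x \<partial>M) - 2 * (\<integral>x. (w x * f x) * (f x - p n x) \<partial>M)
      + (\<integral>x. (w x * (f x - p n x)) * (f x - p n x) \<partial>M)) \<longlonglongrightarrow> (\<integral>x. (w x * f x) * f x \<partial>M) - 2 * 0 + 0"
    by (intro tendsto_intros)
  moreover have "(\<integral>x. w x * (p n x)\<^sup>2 \<partial>M) = (\<integral>x. (w x * f x) * f x \<partial>M) - 2 * (\<integral>x. (w x * f x) * (f x - p n x) \<partial>M)
      + (\<integral>x. (w x * (f x - p n x)) * (f x - p n x) \<partial>M)" for n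
  proof -
    have "(\<integral>x. w x * (p n x)\<^sup>2 \<partial>M) = (\<integral>x. (w x * f x) * f x - 2 * ((w x * f x) * (f x - p n x))
      + (w x * (f x - p n x)) * (f x - p n x) \<partial>M)"
      by (intro Bochner_Integration.integral_cong) (auto simp: power2_eq_square algebra_simps)
    then show ?thesis using i1 i2 i3 by simp
  qed
  ultimately show ?thesis by (simp add: power2_eq_square mult.assoc)
qed

text \<open>Both inequalities hold for the projections, and their energies are replaced by the fixed
  upper bound \<open>form g g\<close> before the limit, so only weighted L2 integrals have to
  converge.\<close>

lemma weak_poincare_and_uncertainty:
  assumes f: "weakly f g" and mean: "(\<integral>x. f x \<partial>M) = 0" and e: "norm e = 1"
  shows "(2 * lam CARD('n) \<mu> + 1) * (\<integral>x. (f x)\<^sup>2 \<partial>M) \<le> form g g"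
    and "((lam CARD('n) \<mu> + 1/2) * (\<integral>x. (x \<bullet> e) * (f x)\<^sup>2 \<partial>M))\<^sup>2 \<le> (\<integral>x. (1 - (x \<bullet> e)\<^sup>2) * (f x)\<^sup>2 \<partial>M) * form g g"
proof -
  have sf: "sq f" using f by (simp add: weakly_def)
  obtain p where p: "\<And>n. p n \<in> Pol n" and orth: "\<And>n s. s \<in> Pol n \<Longrightarrow> (\<integral>x. (f x - p n x) * s x \<partial>M) = 0"
    using ex_projection[OF sf] by metis
  note sp = sq_Pol[OF p]
  have lim: "(\<lambda>n. \<integral>x. (f x - p n x)\<^sup>2 \<partial>M) \<longlonglongrightarrow> 0"
    by (rule projections_converge[OF sf p orth])
  have le: "form (pgrad (p n)) (pgrad (p n)) \<le> form g g" for n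
    by (rule form_projection_le[OF f p orth])
  have meas: "(\<lambda>x::real^'n. x \<bullet> e) \<in> borel_measurable lebesgue_ball"
    by (rule Pol_measurable[OF Pol_inner])
  have t: "\<bar>x \<bullet> e\<bar> \<le> 1" if "x \<in> ball 0 1" for x
    using Cauchy_Schwarz_ineq2[of x e] that e by simp
  note T = integral_weighted_square_tendsto[OF sf sp lim]
  have T1: "(\<lambda>n. \<integral>x. (p n x)\<^sup>2 \<partial>M) \<longlonglongrightarrow> (\<integral>x. (f x)\<^sup>2 \<partial>M)"
    using T[of "\<lambda>x. 1"] by simp
  have T2: "(\<lambda>n. \<integral>x. (x \<bullet> e) * (p n x)\<^sup>2 \<partial>M) \<longlonglongrightarrow> (\<integral>x. (x \<bullet> e) * (f x)\<^sup>2 \<partial>M)"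
    by (rule T[OF meas t])
  have t2: "\<bar>1 - (x \<bullet> e)\<^sup>2\<bar> \<le> 1" if "x \<in> ball 0 1" for x
    using power_mono[OF t[OF that], of 2] by (simp add: abs_le_iff)
  have T3: "(\<lambda>n. \<integral>x. (1 - (x \<bullet> e)\<^sup>2) * (p n x)\<^sup>2 \<partial>M) \<longlonglongrightarrow> (\<integral>x. (1 - (x \<bullet> e)\<^sup>2) * (f x)\<^sup>2 \<partial>M)"
    by (rule T[OF _ t2]) (use meas in measurable)
  \<comment> \<open>The constant 1 belongs to \<open>Pol\<close> only from index 1 on, hence the
    shift.\<close>
  have p0: "(\<integral>x. p (Suc n) x \<partial>M) = 0" for n
  proof -
    have "(\<integral>x. (f x - p (Suc n) x) * 1 \<partial>M) = 0"
      by (rule orth[OF Pol_const])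
    then show ?thesis using mean sq_integrable[OF sf] sq_integrable[OF sp] by simp
  qed
  show "(2 * lam CARD('n) \<mu> + 1) * (\<integral>x. (f x)\<^sup>2 \<partial>M) \<le> form g g"
  proof (rule LIMSEQ_le_const2)
    show "(\<lambda>n. (2 * lam CARD('n) \<mu> + 1) * (\<integral>x. (p (Suc n) x)\<^sup>2 \<partial>M)) \<longlonglongrightarrow> (2 * lam CARD('n) \<mu> + 1) * (\<integral>x. (f x)\<^sup>2 \<partial>M)"
      by (intro tendsto_mult tendsto_const LIMSEQ_Suc[OF T1])
    show "\<exists>k. \<forall>n\<ge>k. (2 * lam CARD('n) \<mu> + 1) * (\<integral>x. (p (Suc n) x)\<^sup>2 \<partial>M) \<le> form g g"
      using order_trans[OF poincare_Pol[OF p p0] le] by blast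
  qed
  show "((lam CARD('n) \<mu> + 1/2) * (\<integral>x. (x \<bullet> e) * (f x)\<^sup>2 \<partial>M))\<^sup>2 \<le> (\<integral>x. (1 - (x \<bullet> e)\<^sup>2) * (f x)\<^sup>2 \<partial>M) * form g g"
  proof (rule LIMSEQ_le)
    show "(\<lambda>n. ((lam CARD('n) \<mu> + 1/2) * (\<integral>x. (x \<bullet> e) * (p n x)\<^sup>2 \<partial>M))\<^sup>2) \<longlonglongrightarrow> ((lam CARD('n) \<mu> + 1/2) * (\<integral>x. (x \<bullet> e) * (f x)\<^sup>2 \<partial>M))\<^sup>2"
      by (intro tendsto_intros T2)
    show "(\<lambda>n. (\<integral>x. (1 - (x \<bullet> e)\<^sup>2) * (p n x)\<^sup>2 \<partial>M) * form g g) \<longlonglongrightarrow> (\<integral>x. (1 - (x \<bullet> e)\<^sup>2) * (f x)\<^sup>2 \<partial>M) * form g g"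
      by (intro tendsto_intros T3)
    have "(\<integral>x. (1 - (x \<bullet> e)\<^sup>2) * (p n x)\<^sup>2 \<partial>M) \<ge> 0" for n
      by (rule integral_nonneg_AE, rule AE_I2) (use t2 in \<open>auto simp: M_def intro!: mult_nonneg_nonneg power_le_one_iff[THEN iffD2] abs_square_le_1[THEN iffD2] t\<close>)
    then show "\<exists>k. \<forall>n\<ge>k. ((lam CARD('n) \<mu> + 1/2) * (\<integral>x. (x \<bullet> e) * (p n x)\<^sup>2 \<partial>M))\<^sup>2 \<le> (\<integral>x. (1 - (x \<bullet> e)\<^sup>2) * (p n x)\<^sup>2 \<partial>M) * form g g"
      using order_trans[OF uncertainty_Pol[OF p e] mult_left_mono[OF le]] by blast
  qed
qed

end

section \<open>The theorem\<close>

text \<open>Let kappa = (l + 1/2)^2. For m <= s the bound E >= 2 l suffices. For m > s the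
  hypothesis \<open>u\<close> gives (1 - m) E >= kappa m^2 / (1 + m), which increases in m and
  equals 2 l (1 - s) at m = s. The proof works with denominators cleared.\<close>

lemma min_bound:
  fixes l m E :: real
  assumes l: "l \<ge> 0" and m: "m \<ge> 0" and E: "E \<ge> 2 * l" and u: "((l + 1/2) * m)\<^sup>2 \<le> (1 - m\<^sup>2) * E"
  shows "2 * l * (1 - sqrt (2 * l) / sqrt ((l + 1/2)\<^sup>2 + 2 * l)) \<le> (1 - m) * E"
proof -
  define \<kappa> where "\<kappa> = (l + 1/2)\<^sup>2"
  define s where "s = sqrt (2 * l) / sqrt (\<kappa> + 2 * l)"
  have k: "\<kappa> > 0" using l by (simp add: \<kappa>_def)
  have s: "0 \<le> s" "s < 1" "\<kappa> * s\<^sup>2 = 2 * l * (1 - s\<^sup>2)"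
    using k l by (auto simp: s_def power_divide field_simps)
  have u': "\<kappa> * m\<^sup>2 \<le> (1 - m\<^sup>2) * E" using u by (simp add: \<kappa>_def power_mult_distrib)
  have "2 * l * (1 - s) \<le> (1 - m) * E"
  proof (cases "m \<le> s")
    case True
    then have "(1 - s) * (2 * l) \<le> (1 - m) * E"
      using s E l by (intro mult_mono) auto
    then show ?thesis by (simp add: mult.commute)
  next
    case False
    have "2 * l * (1 - s) * (1 + m) * (1 + s) = \<kappa> * s\<^sup>2 * (1 + m)"
      unfolding s(3) by (simp add: power2_eq_square algebra_simps)
    also have "\<dots> \<le> \<kappa> * m\<^sup>2 * (1 + s)"
    proof -
      \<comment> \<open>Monotonicity of m^2 / (1 + m), cross-multiplied; the difference of the two
        sides factors as below.\<close>
      have "s\<^sup>2 * (1 + m) \<le> m\<^sup>2 * (1 + s)"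
      proof -
        have "0 \<le> (m - s) * (m + s + m * s)" using False s m by simp
        then show ?thesis by (simp add: power2_eq_square algebra_simps)
      qed
      then show ?thesis using k by (simp add: mult.assoc)
    qed
    also have "\<dots> \<le> (1 - m\<^sup>2) * E * (1 + s)"
      using u' s by (intro mult_right_mono) auto
    also have "\<dots> = ((1 - m) * E) * (1 + m) * (1 + s)"
      by (simp add: power2_eq_square algebra_simps)
    finally have "2 * l * (1 - s) * (1 + m) \<le> ((1 - m) * E) * (1 + m)"
      using s by (simp add: mult_le_cancel_right)
    then show ?thesis using m by (simp add: mult_le_cancel_right)
  qed
  then show ?thesis by (simp add: s_def \<kappa>_def)
qed

section \<open>From the weighted norms and the energy to the measure
  \<open>ballM \<mu>\<close>\<close>

lemma L2_square_integrable: "f \<in> L2 \<mu> \<Longrightarrow> square_integrable (ballM \<mu>) f"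
  unfolding L2_def square_integrable_def set_integrable_lebesgue_on
  by (auto simp: integrable_ballM)

lemma b_eq: "b TYPE('n::finite) \<mu> = inverse (\<integral>x. 1 \<partial>(ballM \<mu> :: (real^'n) measure))"
  unfolding b_def set_integral_lebesgue_on by (subst integral_ballM) auto

lemma b_nonneg: "b TYPE('n::finite) \<mu> \<ge> 0"
  unfolding b_eq by simp

lemma L2_norm_power2:
  fixes h :: "real^'n \<Rightarrow> 'b::real_normed_vector"
  shows "(L2_norm \<mu> h)\<^sup>2 = b TYPE('n) \<mu> * (\<integral>x. (norm (h x))\<^sup>2 * W \<mu> x \<partial>lebesgue_on (ball 0 1))"
  unfolding L2_norm_def set_integral_lebesgue_on
  by (intro real_sqrt_pow2 mult_nonneg_nonneg b_nonneg Bochner_Integration.integral_nonneg zero_le_power2 W_nonneg)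

lemma sum_ordered_pairs:
  fixes a :: "'n::{finite,linorder} \<Rightarrow> 'n \<Rightarrow> real"
  assumes "\<And>i j. a j i = a i j" "\<And>i. a i i = 0"
  shows "2 * (\<Sum>(i, j)\<in>{(i, j). i < j}. a i j) = (\<Sum>i\<in>UNIV. \<Sum>j\<in>UNIV. a i j)"
proof -
  have "(\<Sum>i\<in>UNIV. \<Sum>j\<in>UNIV. a i j) = (\<Sum>(i, j)\<in>{(i, j). i < j} \<union> ({(i, j). j < i} \<union> {(i, j). i = j}). a i j)"
    unfolding sum.cartesian_product by (intro sum.cong) auto
  also have "\<dots> = (\<Sum>(i, j)\<in>{(i, j). i < j}. a i j) + ((\<Sum>(i, j)\<in>{(i, j). j < i}. a i j) + (\<Sum>(i, j)\<in>{(i, j). i = j}. a i j))"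
    by (subst sum.union_disjoint; (subst sum.union_disjoint)?) auto
  also have "(\<Sum>(i, j)\<in>{(i, j). i = j}. a i j) = 0"
    by (rule sum.neutral) (auto simp: assms(2))
  also have "(\<Sum>(i, j)\<in>{(i, j). j < i}. a i j) = (\<Sum>(i, j)\<in>{(i, j). i < j}. a i j)"
    by (rule sum.reindex_bij_witness[of _ prod.swap prod.swap]) (auto simp: assms(1))
  finally show ?thesis by simp
qed

text \<open>Lagrange's identity: the sum over all ordered pairs is twice the sum over i < j, because
  the squares are symmetric and vanish on the diagonal.\<close>

lemma abs_grad_D_power2:
  "(abs_grad_D f x)\<^sup>2 = (norm x)\<^sup>2 * (norm (grad f x))\<^sup>2 - (x \<bullet> grad f x)\<^sup>2"
proof -
  let ?a = "\<lambda>i j. (D i j f x)\<^sup>2"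
  let ?v = "grad f x"
  have "(abs_grad_D f x)\<^sup>2 = (\<Sum>(i, j)\<in>{(i, j). i < j}. ?a i j)"
    unfolding abs_grad_D_def power2_abs by (intro real_sqrt_pow2 sum_nonneg) auto
  moreover have "2 * (\<Sum>(i, j)\<in>{(i, j). i < j}. ?a i j) = (\<Sum>i\<in>UNIV. \<Sum>j\<in>UNIV. ?a i j)"
    by (rule sum_ordered_pairs) (auto simp: D_def power2_eq_square algebra_simps)
  moreover have "(\<Sum>i\<in>UNIV. \<Sum>j\<in>UNIV. ?a i j) = 2 * ((x \<bullet> x) * (?v \<bullet> ?v) - (x \<bullet> ?v) * (x \<bullet> ?v))"
  proof -
    have "(\<Sum>i\<in>UNIV. \<Sum>j\<in>UNIV. ?a i j) =
      (\<Sum>i\<in>UNIV. \<Sum>j\<in>UNIV. (x $ i * x $ i) * (?v $ j * ?v $ j))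
      + (\<Sum>i\<in>UNIV. \<Sum>j\<in>UNIV. (x $ j * x $ j) * (?v $ i * ?v $ i))
      - 2 * (\<Sum>i\<in>UNIV. \<Sum>j\<in>UNIV. (x $ i * ?v $ i) * (x $ j * ?v $ j))"
      unfolding sum.distrib[symmetric] sum_subtractf[symmetric] sum_distrib_left
      by (intro sum.cong refl) (simp add: D_def grad_def power2_eq_square algebra_simps)
    also have "(\<Sum>i\<in>UNIV. \<Sum>j\<in>UNIV. (x $ j * x $ j) * (?v $ i * ?v $ i)) = (\<Sum>i\<in>UNIV. \<Sum>j\<in>UNIV. (x $ i * x $ i) * (?v $ j * ?v $ j))"
      by (rule sum.swap)
    finally show ?thesis
      by (simp add: inner_vec_def sum_product)
  qed
  ultimately show ?thesis
    by (simp add: power2_norm_eq_inner power2_eq_square[of "x \<bullet> _"])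
qed

text \<open>By Lagrange's identity the integrands agree after W at mu + 1 is written as (1 - |x|^2)
  times W at mu. The inequality comes from the normalization of the gradient term alone: 1 - |x|^2
  <= 1 makes b at mu + 1 at least b at mu.\<close>

lemma energy_ge_form:
  fixes f :: "real^('n::{finite,linorder}) \<Rightarrow> real"
  assumes wb: "weighted_ball \<mu> M" and g: "\<And>i. square_integrable M (\<lambda>x. grad f x $ i)"
  shows "b TYPE('n) \<mu> * weighted_ball.form M (grad f) (grad f) \<le> energy \<mu> f"
proof -
  interpret weighted_ball \<mu> M by (rule wb)
  let ?r = "\<lambda>x::(real, 'n) vec. 1 - (norm x)\<^sup>2"
  have n1: "0 < ?r x" if "x \<in> ball 0 1" for x
    using that by (simp add: power_less_one_iff)
  have Wr: "W (\<mu> + 1) x = ?r x * W \<mu> x" if "x \<in> ball 0 1" for x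
    using n1[OF that] by (simp add: W_def powr_mult_base add.commute)
  have rm: "?r \<in> borel_measurable lebesgue_ball"
    by (intro measurable_lebesgue_onI) measurable
  have gm: "(\<lambda>x. (norm (grad f x))\<^sup>2) \<in> borel_measurable lebesgue_ball"
    unfolding power2_norm_eq_inner inner_vec_def inner_real_def
    using sq_measurable[OF g] by measurable
  have gi: "integrable M (\<lambda>x. (norm (grad f x))\<^sup>2 * ?r x)"
  proof -
    have "(norm (grad f x))\<^sup>2 * ?r x = (\<Sum>i\<in>UNIV. grad f x $ i * (grad f x $ i * ?r x))" for x
      by (simp only: power2_norm_eq_inner[of "grad f x"] inner_vec_def inner_real_def sum_distrib_right mult.assoc)
    then show ?thesis
      by (simp only:) (intro Bochner_Integration.integrable_sum square_integrable_mult sq_one_minus_norm g)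
  qed
  have ri: "integrable M ?r" using sq_integrable[OF sq_one_minus_norm[OF sq_one]] by simp
  have int_r: "(\<integral>x. ?r x \<partial>M) = (\<integral>x. W (\<mu> + 1) (x :: (real, 'n) vec) \<partial>lebesgue_ball)"
    unfolding integral_M[OF rm]
    by (intro Bochner_Integration.integral_cong) (auto simp: space_restrict_space Wr)
  have b1: "b TYPE('n) (\<mu> + 1) = inverse (\<integral>x. ?r x \<partial>M)"
    unfolding int_r b_def set_integral_lebesgue_on ..
  have b0: "b TYPE('n) \<mu> = inverse (\<integral>x. 1 \<partial>M)"
    unfolding b_eq M_def ..
  have AE_r: "AE x in M. 0 \<le> ?r x"
    by (rule AE_I2) (use n1 in \<open>auto simp: M_def less_imp_le\<close>)
  \<comment> \<open>Positivity is needed before inverting: a zero integral would make b at mu + 1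
    equal to 0 and reverse the comparison.\<close>
  have "(\<integral>x. ?r x \<partial>M) \<noteq> 0"
  proof
    assume "(\<integral>x. ?r x \<partial>M) = 0"
    then have "AE x in M. ?r x = 0"
      using integral_nonneg_eq_0_iff_AE[OF ri AE_r] by simp
    then have "AE x in M. (1::real) = 0"
      using AE_space by eventually_elim (use n1 in \<open>force simp: M_def\<close>)
    then have "(\<integral>x. (1::real) \<partial>M) = (\<integral>x. 0 \<partial>M)"
      by (intro integral_cong_AE) auto
    then show False using mass by simp
  qed
  then have r_pos: "(\<integral>x. ?r x \<partial>M) > 0"
    using integral_nonneg_AE[OF AE_r] by linarith
  have "(\<integral>x. ?r x \<partial>M) \<le> (\<integral>x. 1 \<partial>M)"
    by (rule integral_mono[OF ri integrable_one]) simp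
  then have b_le: "b TYPE('n) \<mu> \<le> b TYPE('n) (\<mu> + 1)"
    unfolding b0 b1 using r_pos by (simp add: le_imp_inverse_le)
  have e1: "(\<integral>x. (norm (grad f x))\<^sup>2 * W (\<mu> + 1) x \<partial>lebesgue_ball) = (\<integral>x. (norm (grad f x))\<^sup>2 * ?r x \<partial>M)"
  proof -
    have "(\<lambda>x. (norm (grad f x))\<^sup>2 * ?r x) \<in> borel_measurable lebesgue_ball" using gm rm by measurable
    then show ?thesis
      unfolding integral_M[OF \<open>(\<lambda>x. (norm (grad f x))\<^sup>2 * ?r x) \<in> borel_measurable lebesgue_ball\<close>]
      by (intro Bochner_Integration.integral_cong) (auto simp: space_restrict_space Wr)
  qed
  have gam_eq: "gam x (grad f x) (grad f x) = (norm (grad f x))\<^sup>2 * ?r x + (abs_grad_D f x)\<^sup>2" for x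
    unfolding abs_grad_D_power2 gam_def
    by (simp add: dot_square_norm power2_eq_square[of "x \<bullet> _"] algebra_simps)
  \<comment> \<open>Written as a difference, the angular term inherits integrability, and from it
    measurability, from \<open>gam\<close> and the radial term.\<close>
  have Deq: "(abs_grad_D f x)\<^sup>2 = gam x (grad f x) (grad f x) - (norm (grad f x))\<^sup>2 * ?r x" for x
    by (simp add: gam_eq)
  have Di: "integrable M (\<lambda>x. (abs_grad_D f x)\<^sup>2)"
    unfolding Deq by (intro Bochner_Integration.integrable_diff gam_integrable g gi)
  then have Dm: "(\<lambda>x. (abs_grad_D f x)\<^sup>2) \<in> borel_measurable lebesgue_ball"
    using borel_measurable_integrable[OF Di] by (simp add: M_def)
  have e2: "(\<integral>x. (norm (abs_grad_D f x))\<^sup>2 * W \<mu> x \<partial>lebesgue_ball) = (\<integral>x. (abs_grad_D f x)\<^sup>2 \<partial>M)"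
    unfolding integral_M[OF Dm] by simp
  have "form (grad f) (grad f) = (\<integral>x. (norm (grad f x))\<^sup>2 * ?r x \<partial>M) + (\<integral>x. (abs_grad_D f x)\<^sup>2 \<partial>M)"
    unfolding form_def gam_eq by (rule Bochner_Integration.integral_add[OF gi Di])
  moreover have "b TYPE('n) \<mu> * (\<integral>x. (norm (grad f x))\<^sup>2 * ?r x \<partial>M) \<le> b TYPE('n) (\<mu> + 1) * (\<integral>x. (norm (grad f x))\<^sup>2 * ?r x \<partial>M)"
    by (intro mult_right_mono[OF b_le] integral_nonneg_AE)
      (use AE_r in \<open>eventually_elim, simp\<close>)
  ultimately show ?thesis
    unfolding energy_def L2_norm_power2 e1 e2 by (simp add: distrib_left)
qed

theorem theorem5p2:
  fixes \<mu> :: real and f :: "real^('n::{finite,linorder}) \<Rightarrow> real"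
  assumes "\<mu> \<ge> 0"
    and "f \<in> W21 \<mu>"
    and "(LINT x:ball 0 1|lebesgue. f x * W \<mu> x) = 0"
    and "L2_norm \<mu> f = 1"
  shows "\<exists>e\<^sub>0\<in>sphere 0 1. (\<forall>e\<in>sphere 0 1. deviation \<mu> f e\<^sub>0 \<le> deviation \<mu> f e) \<and>
           deviation \<mu> f e\<^sub>0 * energy \<mu> f \<ge> C CARD('n) \<mu>"
proof -
  define M where "M = (ballM \<mu> :: (real, 'n) vec measure)"
  define \<beta> where "\<beta> = b TYPE('n) \<mu>"
  \<comment> \<open>Since the inverse of 0 is 0, norm 1 forces the integral of the weight to be
    nonzero. This discharges the assumption \<open>mass\<close> of the locale, and with it
    integrability of the weight.\<close>
  have "\<beta> \<noteq> 0"
    using assms(4) unfolding L2_norm_def \<beta>_def by auto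
  then interpret weighted_ball \<mu> M
    by unfold_locales (use assms(1) in \<open>auto simp: M_def \<beta>_def b_eq\<close>)
  have \<beta>: "\<beta> > 0" using \<open>\<beta> \<noteq> 0\<close> b_nonneg by (simp add: \<beta>_def less_le)
  have fL: "f \<in> L2 \<mu>"
    and W: "(\<exists>g. has_weak_partial i f g) \<and> weak_partial i f \<in> L2 \<mu>" for i
    using assms(2) by (simp_all add: W21_def)
  have gL: "(\<lambda>x. grad f x $ i) \<in> L2 \<mu>" for i
    using W[of i] by (simp add: grad_def)
  have gw: "has_weak_partial i f (\<lambda>x. grad f x $ i)" for i
    using someI_ex[of "has_weak_partial i f"] W[of i] by (simp add: grad_def weak_partial_def)
  have sf: "sq f" and sg: "\<And>i. sq (\<lambda>x. grad f x $ i)"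
    using L2_square_integrable fL gL by (auto simp: M_def)
  have w: "weakly f (grad f)"
    by (simp add: weakly_def sf sg gw)
  have fm: "f \<in> borel_measurable lebesgue_ball" by (rule sq_measurable[OF sf])
  have mean: "(\<integral>x. f x \<partial>M) = 0"
    using assms(3) by (simp add: integral_M[OF fm] set_integral_lebesgue_on)
  have norm1: "\<beta> * (\<integral>x. (f x)\<^sup>2 \<partial>M) = 1"
  proof -
    have "(\<lambda>x. (f x)\<^sup>2) \<in> borel_measurable lebesgue_ball" using fm by measurable
    then show ?thesis
      using L2_norm_power2[of \<mu> f] assms(4) by (simp add: integral_M \<beta>_def)
  qed
  \<comment> \<open>The center of mass of the probability density proportional to f^2 with respect
    to \<open>M\<close>. The deviation is 1 - <v, e>, so the minimum over the sphere is attained in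
    the direction of v.\<close>
  define v where "v = (\<chi> i. \<beta> * (\<integral>x. x $ i * (f x)\<^sup>2 \<partial>M))"
  have xf: "integrable M (\<lambda>x. x $ i * (f x)\<^sup>2)" for i
    using square_integrable_mult[OF sq_coord[OF sf] sf, of i] by (simp add: power2_eq_square mult.assoc)
  have ve: "v \<bullet> e = \<beta> * (\<integral>x. (x \<bullet> e) * (f x)\<^sup>2 \<partial>M)" for e
  proof -
    have "(\<integral>x. (x \<bullet> e) * (f x)\<^sup>2 \<partial>M) = (\<integral>x. (\<Sum>i\<in>UNIV. e $ i * (x $ i * (f x)\<^sup>2)) \<partial>M)"
      by (simp add: inner_vec_def sum_distrib_left sum_distrib_right mult_ac)
    also have "\<dots> = (\<Sum>i\<in>UNIV. e $ i * (\<integral>x. x $ i * (f x)\<^sup>2 \<partial>M))"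
      using xf by simp
    finally show ?thesis
      by (simp add: v_def inner_vec_def sum_distrib_left mult_ac)
  qed
  have te: "integrable M (\<lambda>x. (x \<bullet> e) * (f x)\<^sup>2)" for e
    using square_integrable_mult[OF sq_Pol_mult[OF Pol_inner sf] sf, of e] by (simp add: power2_eq_square mult.assoc)
  have f2: "integrable M (\<lambda>x. (f x)\<^sup>2)" using sf by (simp add: square_integrable_def)
  have dev: "deviation \<mu> f e = 1 - v \<bullet> e" for e
  proof -
    have "(\<lambda>x. (1 - x \<bullet> e) * (f x)\<^sup>2) \<in> borel_measurable lebesgue_ball"
      using fm Pol_measurable[OF Pol_inner[of e]] by measurable
    from integral_M[OF this] have "deviation \<mu> f e = \<beta> * (\<integral>x. (1 - x \<bullet> e) * (f x)\<^sup>2 \<partial>M)"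
      unfolding deviation_def set_integral_lebesgue_on by (simp add: \<beta>_def)
    also have "(\<integral>x. (1 - x \<bullet> e) * (f x)\<^sup>2 \<partial>M) = (\<integral>x. (f x)\<^sup>2 \<partial>M) - (\<integral>x. (x \<bullet> e) * (f x)\<^sup>2 \<partial>M)"
      using te[of e] f2 by (simp add: left_diff_distrib)
    finally show ?thesis using norm1 ve[of e] by (simp add: right_diff_distrib)
  qed
  obtain e where e: "norm e = 1" "v \<bullet> e = norm v"
  proof (cases "v = 0")
    case True
    \<comment> \<open>With v = 0 the deviation is constant on the sphere, and any unit vector will
      do.\<close>
    then show ?thesis using that[of "axis undefined 1"] by simp
  next
    case False
    then show ?thesis using that[of "v /\<^sub>R norm v"]
      by (simp add: dot_square_norm power2_eq_square)
  qed
  have min: "deviation \<mu> f e \<le> deviation \<mu> f e'" if "e' \<in> sphere 0 1" for e'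
    unfolding dev e(2) using norm_cauchy_schwarz[of v e'] that by simp
  define E where "E = \<beta> * form (grad f) (grad f)"
  let ?l = "lam CARD('n) \<mu>"
  let ?t = "\<lambda>x. x \<bullet> e"
  note P = weak_poincare_and_uncertainty[OF w mean e(1)]
  have "\<beta> * ((2 * ?l + 1) * (\<integral>x. (f x)\<^sup>2 \<partial>M)) \<le> E"
    unfolding E_def using P(1) \<beta> by (intro mult_left_mono) auto
  also have "\<beta> * ((2 * ?l + 1) * (\<integral>x. (f x)\<^sup>2 \<partial>M)) = 2 * ?l + 1"
    using norm1 by (simp add: mult.left_commute)
  \<comment> \<open>As lambda >= 0 this also gives E >= 1, which settles the sign arguments
    below.\<close>
  finally have E: "E \<ge> 2 * ?l + 1" .
  define m where "m = norm v"
  define J where "J = (\<integral>x. (?t x)\<^sup>2 * (f x)\<^sup>2 \<partial>M)"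
  define F where "F = (\<integral>x. (f x)\<^sup>2 \<partial>M)"
  define T where "T = (\<integral>x. ?t x * (f x)\<^sup>2 \<partial>M)"
  have m: "m = \<beta> * T" using ve[of e] e(2) by (simp add: m_def T_def)
  have bF: "\<beta> * F = 1" using norm1 by (simp add: F_def)
  have st: "sq (\<lambda>x. ?t x * f x)" by (rule sq_Pol_mult[OF Pol_inner sf])
  have iJ: "integrable M (\<lambda>x. (?t x)\<^sup>2 * (f x)\<^sup>2)"
    using st by (simp add: square_integrable_def power_mult_distrib)
  \<comment> \<open>Cauchy-Schwarz bounds the squared mean of t by its second moment under the
    probability density. The uncertainty inequality can then be stated through m alone, in the form
    that \<open>min_bound\<close> expects.\<close>
  have "T\<^sup>2 \<le> J * F"
    using integral_Cauchy_Schwarz[OF st sf]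
    by (simp add: T_def J_def F_def power_mult_distrib power2_eq_square mult_ac)
  then have "\<beta>\<^sup>2 * T\<^sup>2 \<le> \<beta>\<^sup>2 * (J * F)" by (intro mult_left_mono) auto
  also have "\<beta>\<^sup>2 * (J * F) = \<beta> * J * (\<beta> * F)" by (simp add: power2_eq_square)
  finally have mJ: "m\<^sup>2 \<le> \<beta> * J" by (simp add: m bF power_mult_distrib)
  have U: "((?l + 1/2) * T)\<^sup>2 \<le> (F - J) * form (grad f) (grad f)"
  proof -
    have "(\<integral>x. (1 - (?t x)\<^sup>2) * (f x)\<^sup>2 \<partial>M) = F - J"
      using iJ f2 by (simp add: F_def J_def left_diff_distrib)
    then show ?thesis using P(2) by (simp add: T_def)
  qed
  have "((?l + 1/2) * m)\<^sup>2 = \<beta>\<^sup>2 * ((?l + 1/2) * T)\<^sup>2"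
    by (simp add: m power_mult_distrib)
  also have "\<dots> \<le> \<beta>\<^sup>2 * ((F - J) * form (grad f) (grad f))"
    by (intro mult_left_mono U) auto
  also have "\<dots> = (\<beta> * F - \<beta> * J) * E"
    by (simp add: E_def power2_eq_square algebra_simps)
  also have "\<dots> \<le> (1 - m\<^sup>2) * E"
    using mJ E lam_nonneg by (intro mult_right_mono) (auto simp: bF)
  finally have u: "((?l + 1/2) * m)\<^sup>2 \<le> (1 - m\<^sup>2) * E" .
  have "C CARD('n) \<mu> \<le> (1 - m) * E"
    unfolding C_def by (rule min_bound[OF lam_nonneg _ _ u]) (use E in \<open>auto simp: m_def\<close>)
  also have "\<dots> \<le> (1 - m) * energy \<mu> f"
  proof (rule mult_left_mono)
    show "E \<le> energy \<mu> f"
      unfolding E_def \<beta>_def by (rule energy_ge_form[OF weighted_ball_axioms sg])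
    \<comment> \<open>The uncertainty inequality bounds a square by this product, so together with E
      > 0 it yields m <= 1.\<close>
    have "(1 - m\<^sup>2) * E \<ge> 0" using u zero_le_power2 order_trans by blast
    then have "m\<^sup>2 \<le> 1" using E lam_nonneg by (simp add: zero_le_mult_iff)
    then show "0 \<le> 1 - m" by (simp add: abs_square_le_1)
  qed
  finally have "deviation \<mu> f e * energy \<mu> f \<ge> C CARD('n) \<mu>"
    by (simp add: dev e(2) m_def)
  then show ?thesis
    using min e(1) by (intro bexI[of _ e]) auto
qed

end
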